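(* Let $\bar T>0$ be given. Consider the switched system $$\partial_\tau\bar x(t_k+\tau)=\bar A_{\sigma(t_k+\tau)}(\tau)\bar x(t_k+\tau)+\bar B_{\sigma(t_k+\tau)}(\tau)\bar u(t_k+\tau)+\bar E_{\sigma(t_k+\tau)}(\tau)w(t_k+\tau),$$ $$\bar z(t_k+\tau)=\bar C_{\sigma(t_k+\tau)}(\tau)\bar x(t_k+\tau)+\bar D_{\sigma(t_k+\tau)}(\tau)\bar u(t_k+\tau)+\bar F_{\sigma(t_k+\tau)}(\tau)w(t_k+\tau),$$ $\tau\in(0,T_k]$, $T_k=t_{k+1}-t_k$, $k\ge0$, with switching signal $\sigma:\mathbb{R}_{\ge0}\to\{1,\ldots,N\}$, where $\bar A_i(\tau)=\bar A_i(\bar T)$, $\bar B_i(\tau)=\bar B_i(\bar T)$, $\bar E_i(\tau)=\bar E_i(\bar T)$, $\bar C_i(\tau)=\bar C_i(\bar T)$, $\bar D_i(\tau)=\bar D_i(\bar T)$ and $\bar F_i(\tau)=\bar F_i(\bar T)$ for all $\tau\ge\bar T$, and assume that it is internally positive. Consider the controller $\bar u(t_k+\tau)=\bar K_{\sigma(t_k+\tau)}(\tau)\bar x(t_k+\tau)$ for $\tau\in(0,\bar T]$ and $\bar u(t_k+\tau)=\bar K_{\sigma(t_k+\tau)}(\bar T)\bar x(t_k+\tau)$ for $\tau\in(\bar T,T_k]$. Assume further that there exist differentiable matrix-valued functions $X_i:[0,\bar T]\to\mathbb{D}^n$, $X_i(\bar T)\succ0$, matrix-valued functions $U_i:[0,\bar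 T]\to\mathbb{R}^{m\times n}$, $i=1,\ldots,N$, and scalars $\gamma,\alpha>0$ such that $$\bar A_i(\tau)X_i(\tau)+\bar B_i(\tau)U_i(\tau)+\alpha I\ge0,\qquad \bar C_i(\tau)X_i(\tau)+\bar D_i(\tau)U_i(\tau)\ge0$$ and $$\begin{array}{rcl} [\bar A_i(\bar T)X_i(\bar T)+\bar B_i(\bar T)U_i(\bar T)]\mathbf 1+\bar E_i(\bar T)\mathbf 1&<&0,\\ {}[\bar C_i(\bar T)X_i(\bar T)+\bar D_i(\bar T)U_i(\bar T)]\mathbf 1+\bar F_i(\bar T)\mathbf 1-\gamma\mathbf 1&<&0,\\ {}[-\dot X_i(\tau)+\bar A_i(\tau)X_i(\tau)+\bar B_i(\tau)U_i(\tau)]\mathbf 1+\bar E_i(\tau)\mathbf 1&<&0,\\ {}[\bar C_i(\tau)X_i(\tau)+\bar D_i(\tau)U_i(\tau)]\mathbf 1+\bar F_i(\tau)\mathbf 1-\gamma\mathbf 1&<&0,\\ X_i(\bar T)-X_j(0)&\le&0 \end{array}$$ hold for all $\tau\in[0,\bar T]$ and all $i,j=1,\ldots,N$, $i\ne j$. Then the closed-loop system is asymptotically stable under minimum dwell-time $\bar T$ with the controller gains $\bar K_i(\tau)=U_i(\tau)X_i(\tau)^{-1}$ and the $L_\infty$-gain of the transfer $w\mapsto\bar z$ is at most $\gamma$.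
   Context: Inequalities are componentwise; $\mathbf 1$ is the all-ones vector; $\mathbb{D}^n$ is the set of $n\times n$ diagonal matrices and $\succ0$ means positive definite. $\bar x(t)\in\mathbb{R}^n$ is continuous in time, $\bar u(t)\in\mathbb{R}^m$; $\sigma$ changes value only at the switching times $t_k$, $k\ge1$, is constant on each $(t_k,t_{k+1}]$, and $\tau$ is the time elapsed since the last switching time. Matrix functions are continuous and bounded. Internal positivity (with $\bar u\equiv0$): each $\bar A_i(\tau)$ is Metzler (nonnegative off-diagonal entries) and $\bar E_i(\tau),\bar C_i(\tau),\bar F_i(\tau)$ are nonnegative. Minimum dwell-time $\bar T$: all switching sequences with $t_0=0$ and $t_{k+1}-t_k\ge\bar T$, $k\ge0$, are considered; stability refers to $w\equiv0$. The $L_\infty$-gain is the supremum of $\|\bar z\|_{L_\infty}$ over $\|w\|_{L_\infty}=1$, zero initial state, and all these switching signals.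
   Formalization: The matrices X_i(τ) are additionally assumed invertible on [0,T̄], since the inequalities alone do not guarantee that the gains U_i X_i^{-1} exist; U_i is taken continuous, and every switching time is a genuine change of mode. *)

theory Defs
  imports "HOL-Analysis.Analysis" "HOL-Probability.Essential_Supremum"
begin

text \<open>
  Vectors are \<^typ>\<open>real ^ 'n\<close>. The library order \<open>\<le>\<close> on vectors and matrices is entrywise, but
  the library \<open><\<close> on them is not the strict entrywise order, so strict vector inequalities are
  written out by components. The vector \<open>1\<close> is the all-ones vector and \<open>mat 1\<close> is the identity.
\<close>

definition metzler :: "real^'n^'n \<Rightarrow> bool" where
  "metzler M \<longleftrightarrow> (\<forall>r s. r \<noteq> s \<longrightarrow> 0 \<le> M $ r $ s)"

definition diagonal :: "real^'n^'n \<Rightarrow> bool" where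
  "diagonal M \<longleftrightarrow> (\<forall>r s. r \<noteq> s \<longrightarrow> M $ r $ s = 0)"

definition positive_definite :: "real^'n^'n \<Rightarrow> bool" where
  "positive_definite M \<longleftrightarrow> transpose M = M \<and> (\<forall>v. v \<noteq> 0 \<longrightarrow> 0 < v \<bullet> (M *v v))"

definition timer_coeff :: "real \<Rightarrow> (real \<Rightarrow> real^'c^'r) \<Rightarrow> bool" where
  "timer_coeff Tb M \<longleftrightarrow>
     continuous_on {0..} M \<and> bounded (M ` {0..}) \<and> (\<forall>\<tau>\<ge>Tb. M \<tau> = M Tb)"

definition internally_positive ::
  "nat \<Rightarrow> (nat \<Rightarrow> real \<Rightarrow> real^'n^'n) \<Rightarrow> (nat \<Rightarrow> real \<Rightarrow> real^'p^'n) \<Rightarrow>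
   (nat \<Rightarrow> real \<Rightarrow> real^'n^'q) \<Rightarrow> (nat \<Rightarrow> real \<Rightarrow> real^'p^'q) \<Rightarrow> bool" where
  "internally_positive N A E C F \<longleftrightarrow>
     (\<forall>i\<in>{1..N}. \<forall>\<tau>\<ge>0. metzler (A i \<tau>) \<and> 0 \<le> E i \<tau> \<and> 0 \<le> C i \<tau> \<and> 0 \<le> F i \<tau>)"

text \<open>
  The value \<open>t k = \<infinity>\<close> means that there are fewer than \<open>k\<close> switches, so signals with finitely many
  switches are included; \<open>t k = \<infinity>\<close> forces \<open>t (Suc k) = \<infinity>\<close>. The last conjunct says that a finite
  \<open>t (Suc k)\<close> is a time at which the mode really changes: the timer is never reset without a
  change of mode, in accordance with conditions that couple distinct modes only.
\<close>

definition dwell_signal ::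
  "real \<Rightarrow> nat \<Rightarrow> (nat \<Rightarrow> ereal) \<Rightarrow> (real \<Rightarrow> nat) \<Rightarrow> bool" where
  "dwell_signal Tb N t \<sigma> \<longleftrightarrow>
     t 0 = 0 \<and> (\<forall>k. t k + ereal Tb \<le> t (Suc k)) \<and>
     (\<forall>s\<ge>0. \<sigma> s \<in> {1..N}) \<and>
     (\<forall>k. \<sigma> constant_on {s. t k < ereal s \<and> ereal s \<le> t (Suc k)}) \<and>
     (\<forall>k s. t (Suc k) < ereal s \<and> ereal s \<le> t (Suc (Suc k)) \<longrightarrow>
        \<sigma> s \<noteq> \<sigma> (real_of_ereal (t (Suc k))))"

text \<open>\<open>in_phase t k \<tau>\<close> says that \<open>t k\<close> is finite and \<open>\<tau> \<in> (0, T\<^sub>k]\<close> with \<open>T\<^sub>k = t (Suc k) - t k\<close>.\<close>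

definition in_phase :: "(nat \<Rightarrow> ereal) \<Rightarrow> nat \<Rightarrow> real \<Rightarrow> bool" where
  "in_phase t k \<tau> \<longleftrightarrow> t k < \<infinity> \<and> 0 < \<tau> \<and> t k + ereal \<tau> \<le> t (Suc k)"

text \<open>
  Disturbances are merely essentially bounded and measurable, so the differential equation is
  understood in the sense of Caratheodory: a continuous \<open>x\<close> that satisfies the equation
  integrated over the phase from \<open>t k\<close>.
\<close>

definition state_equation ::
  "(nat \<Rightarrow> real \<Rightarrow> real^'n^'n) \<Rightarrow> (nat \<Rightarrow> real \<Rightarrow> real^'m^'n) \<Rightarrow> (nat \<Rightarrow> real \<Rightarrow> real^'p^'n) \<Rightarrow>
   (nat \<Rightarrow> ereal) \<Rightarrow> (real \<Rightarrow> nat) \<Rightarrow>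
   (real \<Rightarrow> real^'m) \<Rightarrow> (real \<Rightarrow> real^'p) \<Rightarrow> (real \<Rightarrow> real^'n) \<Rightarrow> bool" where
  "state_equation A B E t \<sigma> u w x \<longleftrightarrow>
     continuous_on {0..} x \<and>
     (\<forall>k \<tau>. in_phase t k \<tau> \<longrightarrow>
        (let tk = real_of_ereal (t k) in
          ((\<lambda>s. A (\<sigma> (tk + s)) s *v x (tk + s) + B (\<sigma> (tk + s)) s *v u (tk + s)
                 + E (\<sigma> (tk + s)) s *v w (tk + s))
            has_integral (x (tk + \<tau>) - x tk)) {0..\<tau>}))"

definition output_equation ::
  "(nat \<Rightarrow> real \<Rightarrow> real^'n^'q) \<Rightarrow> (nat \<Rightarrow> real \<Rightarrow> real^'m^'q) \<Rightarrow> (nat \<Rightarrow> real \<Rightarrow> real^'p^'q) \<Rightarrow>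
   (nat \<Rightarrow> ereal) \<Rightarrow> (real \<Rightarrow> nat) \<Rightarrow>
   (real \<Rightarrow> real^'m) \<Rightarrow> (real \<Rightarrow> real^'p) \<Rightarrow> (real \<Rightarrow> real^'n) \<Rightarrow> (real \<Rightarrow> real^'q) \<Rightarrow> bool" where
  "output_equation C D F t \<sigma> u w x z \<longleftrightarrow>
     (\<forall>k \<tau>. in_phase t k \<tau> \<longrightarrow>
        (let s = real_of_ereal (t k) + \<tau> in
          z s = C (\<sigma> s) \<tau> *v x s + D (\<sigma> s) \<tau> *v u s + F (\<sigma> s) \<tau> *v w s))"

definition state_feedback ::
  "real \<Rightarrow> (nat \<Rightarrow> real \<Rightarrow> real^'n^'m) \<Rightarrow> (nat \<Rightarrow> ereal) \<Rightarrow> (real \<Rightarrow> nat) \<Rightarrow>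
   (real \<Rightarrow> real^'n) \<Rightarrow> (real \<Rightarrow> real^'m) \<Rightarrow> bool" where
  "state_feedback Tb K t \<sigma> x u \<longleftrightarrow>
     (\<forall>k \<tau>. in_phase t k \<tau> \<longrightarrow>
        (let s = real_of_ereal (t k) + \<tau> in
          u s = (if \<tau> \<le> Tb then K (\<sigma> s) \<tau> else K (\<sigma> s) Tb) *v x s))"

definition asymptotically_stable_dwell ::
  "real \<Rightarrow> nat \<Rightarrow> (nat \<Rightarrow> real \<Rightarrow> real^'n^'n) \<Rightarrow> (nat \<Rightarrow> real \<Rightarrow> real^'m^'n) \<Rightarrow>
   (nat \<Rightarrow> real \<Rightarrow> real^'p^'n) \<Rightarrow> (nat \<Rightarrow> real \<Rightarrow> real^'n^'m) \<Rightarrow> bool" where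
  "asymptotically_stable_dwell Tb N A B E K \<longleftrightarrow>
     (\<forall>t \<sigma>. dwell_signal Tb N t \<sigma> \<longrightarrow>
        (\<forall>\<epsilon>>0. \<exists>\<delta>>0. \<forall>x u.
           state_equation A B E t \<sigma> u (\<lambda>_. 0) x \<and> state_feedback Tb K t \<sigma> x u \<and> norm (x 0) < \<delta>
           \<longrightarrow> (\<forall>s\<ge>0. norm (x s) < \<epsilon>)) \<and>
        (\<forall>x u. state_equation A B E t \<sigma> u (\<lambda>_. 0) x \<and> state_feedback Tb K t \<sigma> x u
           \<longrightarrow> (x \<longlongrightarrow> 0) at_top))"

text \<open>Pointwise in time, the norm of a vector is its largest absolute component.\<close>

definition Linf_norm :: "(real \<Rightarrow> real^'k) \<Rightarrow> ereal" where
  "Linf_norm f = esssup (lebesgue_on {0..}) (\<lambda>s. ereal (infnorm (f s)))"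

definition Linf_gain_dwell ::
  "real \<Rightarrow> nat \<Rightarrow> (nat \<Rightarrow> real \<Rightarrow> real^'n^'n) \<Rightarrow> (nat \<Rightarrow> real \<Rightarrow> real^'m^'n) \<Rightarrow>
   (nat \<Rightarrow> real \<Rightarrow> real^'p^'n) \<Rightarrow> (nat \<Rightarrow> real \<Rightarrow> real^'n^'q) \<Rightarrow> (nat \<Rightarrow> real \<Rightarrow> real^'m^'q) \<Rightarrow>
   (nat \<Rightarrow> real \<Rightarrow> real^'p^'q) \<Rightarrow> (nat \<Rightarrow> real \<Rightarrow> real^'n^'m) \<Rightarrow> ereal" where
  "Linf_gain_dwell Tb N A B E C D F K =
     Sup {Linf_norm z | t \<sigma> w x u z.
            dwell_signal Tb N t \<sigma> \<and>
            w \<in> borel_measurable (lebesgue_on {0..}) \<and> Linf_norm w = 1 \<and> x 0 = 0 \<and>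
            state_equation A B E t \<sigma> u w x \<and> state_feedback Tb K t \<sigma> x u \<and>
            output_equation C D F t \<sigma> u w x z}"

end

theory Submission
  imports Defs
begin

text \<open>
  A diagonal certificate \<open>X i\<close> is read through the vector \<open>\<xi> i s = X i s *v 1\<close> of its diagonal entries,
  and \<open>\<xi>\<close> is read as a moving box \<open>\<bar>x\<bar> \<le> \<xi>\<close> for the state. The entries of \<open>\<xi>\<close> are positive: they are
  positive at \<open>Tb\<close>, and invertibility keeps them from vanishing before. For the closed-loop matrix
  \<open>M = A + B ** K\<close> one has \<open>M ** X = A ** X + B ** U\<close>, so the first matrix inequality says that \<open>M\<close> is
  Metzler, and the vector inequalities say that \<open>\<xi>' > M *v \<xi> + E *v 1\<close> on the dwell interval and
  \<open>0 > M *v \<xi> + E *v 1\<close> once the coefficients have frozen: \<open>\<xi>\<close> is a strict supersolution for every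
  disturbance bounded by \<open>1\<close>.

  Gain. For a cooperative system a trajectory cannot leave a box whose faces are strict
  supersolutions: at a first contact with the face \<open>p\<close>, all other components are still inside, so by the
  signs of the off-diagonal entries they drive \<open>x p\<close> more slowly than the face moves, and \<open>x p\<close> would
  have been outside just before
  (\<open>positive_comparison\<close>). At a switch from mode \<open>i\<close> to mode \<open>j\<close> the inequality
  \<open>\<xi> i Tb \<le> \<xi> j 0\<close> puts the state inside the next box. Started at rest, the state stays in the boxes forever
  (\<open>forced_trajectory_bound\<close>), and since \<open>C + D ** K\<close> and \<open>F\<close> are nonnegative the output is bounded by
  \<open>(C + D ** K) *v \<xi> + F *v 1 < \<gamma>\<close>.

  Stability. Strictness has to be converted into a uniform contraction. As \<open>X\<close> is merely differentiable,
  \<open>\<xi>' - M *v \<xi>\<close> is positive but may have infimum zero, so it need not leave room for a factor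
  \<open>exp (- \<beta> * s)\<close> on \<open>\<xi>\<close>. Its integral over the dwell interval is positive, however, and subtracting a fraction of the
  integrated slack from \<open>\<xi>\<close> gives another supersolution, with the same initial value and a strictly
  smaller value at \<open>Tb\<close> (\<open>supersolution_with_end_gap\<close>). The gap leaves room for
  \<open>exp (- \<beta> * Tb)\<close> with a small \<open>\<beta> > 0\<close> common to the finitely many modes, and after \<open>Tb\<close> the strict inequality
  \<open>M *v \<xi> < 0\<close> for constant coefficients leaves room for the same rate. Hence a phase that has lasted
  \<open>\<tau> \<ge> Tb\<close> contributes a factor \<open>exp (- \<beta> * \<tau>)\<close>, and trajectories decay exponentially at a rate
  that does not depend on the switching signal (\<open>unforced_trajectory_decay\<close>).
\<close>

section \<open>Matrix products and integrals\<close>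

lemma continuous_on_matrix_vector_mult [continuous_intros]:
  fixes M :: "'a::topological_space \<Rightarrow> real^'n^'m"
  assumes "continuous_on S M" "continuous_on S v"
  shows "continuous_on S (\<lambda>s. M s *v v s)"
  unfolding matrix_vector_mult_def using assms by (intro continuous_intros)

lemma continuous_on_matrix_matrix_mult [continuous_intros]:
  fixes M :: "'a::topological_space \<Rightarrow> real^'n^'m" and P :: "'a \<Rightarrow> real^'p^'n"
  assumes "continuous_on S M" "continuous_on S P"
  shows "continuous_on S (\<lambda>s. M s ** P s)"
  unfolding matrix_matrix_mult_def using assms by (intro continuous_intros)

lemma abs_matrix_vector_mult_le:
  fixes M :: "real^'n^'m"
  assumes "\<And>q. 0 \<le> M $ r $ q" and "\<And>q. \<bar>v $ q\<bar> \<le> b $ q"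
  shows "\<bar>(M *v v) $ r\<bar> \<le> (M *v b) $ r"
proof -
  have "\<bar>(M *v v) $ r\<bar> \<le> (\<Sum>q\<in>UNIV. \<bar>M $ r $ q * v $ q\<bar>)"
    unfolding matrix_vector_mult_def by (simp add: sum_abs)
  also have "\<dots> \<le> (M *v b) $ r"
    unfolding matrix_vector_mult_def
    by (simp, intro sum_mono) (simp add: abs_mult assms mult_left_mono)
  finally show ?thesis .
qed

lemma matrix_vector_mult_split_diagonal:
  fixes M :: "real^'n^'n"
  shows "(M *v v) $ r = M $ r $ r * v $ r + (\<Sum>q\<in>UNIV-{r}. M $ r $ q * v $ q)"
  unfolding matrix_vector_mult_def by (simp add: sum.remove[of UNIV r])

lemma has_integral_increment:
  fixes h y :: "real \<Rightarrow> 'a::banach"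
  assumes "\<And>s. s \<in> {a..b} \<Longrightarrow> (h has_integral (y s - y a)) {a..s}"
    and "a \<le> u" "u \<le> v" "v \<le> b"
  shows "(h has_integral (y v - y u)) {u..v}"
proof -
  have I: "h integrable_on {a..v}" "integral {a..v} h = y v - y a" "integral {a..u} h = y u - y a"
    using assms(1)[of v] assms(1)[of u] assms(2-) by (auto simp: has_integral_iff)
  then have "h integrable_on {u..v}"
    using assms(2-) integrable_on_subinterval[of _ "{a..v}" u v] by auto
  moreover have "y u + integral {u..v} h = y v"
    using Henstock_Kurzweil_Integration.integral_combine[OF _ _ I(1), of u] assms(2-) I by auto
  then have "integral {u..v} h = y v - y u"
    by (metis add_diff_cancel_left')
  ultimately show ?thesis by (simp add: has_integral_iff)
qed

lemma has_integral_le_off_negligible: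
  fixes f g :: "real \<Rightarrow> real"
  assumes "(f has_integral i) T" "negligible S" "(g has_integral j) T"
    and "\<And>u. u \<in> T - S \<Longrightarrow> f u \<le> g u"
  shows "i \<le> j"
proof (rule has_integral_le)
  show "((\<lambda>u. if u \<in> S then g u else f u) has_integral i) T"
    using assms(2) _ assms(1) by (rule has_integral_spike) auto
qed (use assms in auto)

section \<open>The comparison principle\<close>

text \<open>
  The disturbance is only measurable, so \<open>x\<close> need not be differentiable anywhere, while the box \<open>\<eta>\<close> is
  differentiable with a possibly discontinuous derivative. The two are therefore compared through a
  third function, the integral of the continuous upper bound for the rate of the touching component:
  integral monotonicity relates it to \<open>x\<close>, and its derivative at the point of contact relates it to \<open>\<eta>\<close>.
  Only left derivatives of \<open>\<eta>\<close> enter, which allows boxes with a kink.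
\<close>

lemma positive_comparison:
  fixes M :: "real \<Rightarrow> real^'n^'n" and f g x \<eta> d :: "real \<Rightarrow> real^'n"
  assumes M: "continuous_on {a..b} M" "\<And>s. s \<in> {a..b} \<Longrightarrow> metzler (M s)"
    and g: "continuous_on {a..b} g"
    and S: "negligible S" "\<And>s r. s \<in> {a..b} - S \<Longrightarrow> \<bar>f s $ r\<bar> \<le> g s $ r"
    and x: "continuous_on {a..b} x"
      "\<And>s. s \<in> {a..b} \<Longrightarrow> ((\<lambda>s. M s *v x s + f s) has_integral (x s - x a)) {a..s}"
    and \<eta>: "continuous_on {a..b} \<eta>"
      "\<And>s. s \<in> {a<..b} \<Longrightarrow> (\<eta> has_vector_derivative d s) (at s within {a..s})"
      "\<And>s r. s \<in> {a<..b} \<Longrightarrow> (M s *v \<eta> s + g s) $ r < d s $ r"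
    and init: "\<And>r. \<bar>x a $ r\<bar> < \<eta> a $ r"
    and \<tau>: "\<tau> \<in> {a..b}"
  shows "\<bar>x \<tau> $ r\<bar> < \<eta> \<tau> $ r"
proof (rule ccontr)
  assume crossed: "\<not> ?thesis"
  define Z where "Z = (\<Union>q. {s\<in>{a..b}. \<eta> s $ q \<le> \<bar>x s $ q\<bar>})"
  have "\<tau> \<in> Z" using crossed \<tau> by (auto simp: Z_def not_less)
  have "closed Z" unfolding Z_def
    by (intro closed_UN finite ballI
        continuous_on_closed_Collect_le continuous_intros x \<eta>)
  moreover have "Z \<subseteq> {a..b}" by (auto simp: Z_def)
  ultimately have "compact Z"
    by (meson bounded_closed_interval bounded_subset compact_eq_bounded_closed)
  (* first time at which some face is reached *)
  then obtain c where c: "c \<in> Z" "\<And>s. s \<in> Z \<Longrightarrow> c \<le> s"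
    using \<open>\<tau> \<in> Z\<close> compact_attains_inf[of Z] by blast
  then obtain p where p: "\<eta> c $ p \<le> \<bar>x c $ p\<bar>" by (auto simp: Z_def)
  have "c \<noteq> a" using p init[of p] by auto
  then have ac: "a < c" "c \<le> b" using \<open>Z \<subseteq> {a..b}\<close> c(1) by force+
  have before: "\<bar>x s $ q\<bar> < \<eta> s $ q" if "a \<le> s" "s < c" for s q
    using that ac c(2)[of s] by (force simp: Z_def not_less)
  have "\<bar>x c $ q\<bar> \<le> \<eta> c $ q" for q
  proof (rule tendsto_le)
    show "at_left c \<noteq> bot" by simp
    have "continuous_on {a..c} x" "continuous_on {a..c} \<eta>"
      using x(1) \<eta>(1) ac by (auto elim!: continuous_on_subset)
    then have "(x \<longlongrightarrow> x c) (at_left c)" "(\<eta> \<longlongrightarrow> \<eta> c) (at_left c)"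
      using ac unfolding continuous_on_def by (auto simp: at_within_Icc_at_left[symmetric])
    then show "((\<lambda>s. \<bar>x s $ q\<bar>) \<longlongrightarrow> \<bar>x c $ q\<bar>) (at_left c)"
      "((\<lambda>s. \<eta> s $ q) \<longlongrightarrow> \<eta> c $ q) (at_left c)"
      by (auto intro!: tendsto_intros)
    show "\<forall>\<^sub>F s in at_left c. \<bar>x s $ q\<bar> \<le> \<eta> s $ q"
      by (rule eventually_at_leftI[of a]) (use before ac in \<open>auto simp: less_imp_le\<close>)
  qed
  then have reach: "\<bar>x c $ p\<bar> = \<eta> c $ p" using p by (metis antisym)
  (* the sign treats the upper and the lower face at once *)
  define \<epsilon> where "\<epsilon> = (if x c $ p \<ge> 0 then 1 else -1 :: real)"
  have \<epsilon>: "\<bar>\<epsilon>\<bar> = 1" "\<epsilon> * x c $ p = \<eta> c $ p" using reach by (auto simp: \<epsilon>_def)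
  have \<epsilon>_le: "\<epsilon> * y \<le> \<bar>y\<bar>" for y by (auto simp: \<epsilon>_def)
  (* The diagonal entry may be negative, so the p-th component itself is kept;
     the other components are replaced by their bounds. *)
  define G where "G s = M s $ p $ p * (\<epsilon> * x s $ p) + (\<Sum>q\<in>UNIV-{p}. M s $ p $ q * \<eta> s $ q) + g s $ p" for s
  have G: "continuous_on {a..c} G" unfolding G_def
    by (intro continuous_intros continuous_on_subset[OF M(1)] continuous_on_subset[OF g]
       continuous_on_subset[OF x(1)] continuous_on_subset[OF \<eta>(1)]) (use ac in auto)
  have Gc: "G c = (M c *v \<eta> c + g c) $ p"
    by (simp add: G_def \<epsilon> matrix_vector_mult_split_diagonal)
  define \<phi> where "\<phi> s = integral {a..s} G" for s
  have "(\<phi> has_real_derivative G c) (at c within {a..c})"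
    unfolding \<phi>_def using integral_has_real_derivative[OF G, of c] ac by auto
  moreover have "((\<lambda>s. \<eta> s $ p) has_real_derivative d c $ p) (at c within {a..c})"
    using \<eta>(2)[of c] ac unfolding has_real_derivative_iff_has_vector_derivative
    by (auto intro: bounded_linear.has_vector_derivative[OF bounded_linear_vec_nth])
  ultimately have "((\<lambda>s. \<eta> s $ p - \<phi> s) has_real_derivative (d c $ p - G c)) (at c within {a..c})"
    by (intro DERIV_diff)
  moreover have "d c $ p - G c > 0" using \<eta>(3)[of c p] ac Gc by simp
  ultimately obtain h where h: "h > 0" "\<forall>k>0. c - k \<in> {a..c} \<longrightarrow> k < h \<longrightarrow>
      \<eta> (c - k) $ p - \<phi> (c - k) < \<eta> c $ p - \<phi> c"
    using has_real_derivative_pos_inc_left by blast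
  obtain k where k: "0 < k" "k < h" "k < c - a"
    using dense[of 0 "min h (c - a)"] h(1) ac by auto
  define s where "s = c - k"
  have s: "a < s" "s < c" using k by (auto simp: s_def)
  have less: "\<eta> s $ p - \<phi> s < \<eta> c $ p - \<phi> c"
    using h(2) k s by (simp add: s_def)
  have "((\<lambda>s. M s *v x s + f s) has_integral (x c - x s)) {s..c}"
    by (rule has_integral_increment[OF x(2)]) (use s ac in auto)
  from has_integral_mult_right[OF has_integral_linear[OF this bounded_linear_vec_nth[of p]], of \<epsilon>]
  have "((\<lambda>s. \<epsilon> * (M s *v x s + f s) $ p) has_integral \<epsilon> * (x c - x s) $ p) {s..c}"
    by (simp add: o_def)
  moreover have "negligible (insert c S)" using S(1) by simp
  moreover have "(G has_integral \<phi> c - \<phi> s) {s..c}"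
  proof -
    have "G integrable_on {a..c}" "G integrable_on {s..c}"
      by (intro integrable_continuous_real continuous_on_subset[OF G], use s in auto)+
    moreover have "integral {s..c} G = \<phi> c - \<phi> s"
      using Henstock_Kurzweil_Integration.integral_combine[of a s c G] s \<open>G integrable_on {a..c}\<close>
      by (auto simp: \<phi>_def algebra_simps)
    ultimately show ?thesis by (simp add: has_integral_iff)
  qed
  moreover have "\<epsilon> * (M u *v x u + f u) $ p \<le> G u" if "u \<in> {s..c} - (insert c S)" for u
  proof -
    have u: "u \<in> {a..b} - S" "a \<le> u" "u < c" using that s ac by auto
    have "\<epsilon> * (\<Sum>q\<in>UNIV-{p}. M u $ p $ q * x u $ q) = (\<Sum>q\<in>UNIV-{p}. M u $ p $ q * (\<epsilon> * x u $ q))"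
      by (simp add: sum_distrib_left mult_ac)
    also have "\<dots> \<le> (\<Sum>q\<in>UNIV-{p}. M u $ p $ q * \<eta> u $ q)"
    proof (intro sum_mono mult_left_mono)
      fix q assume "q \<in> UNIV - {p}"
      then show "0 \<le> M u $ p $ q" using M(2)[of u] u by (auto simp: metzler_def)
      show "\<epsilon> * x u $ q \<le> \<eta> u $ q" using \<epsilon>_le[of "x u $ q"] before[OF u(2,3), of q] by linarith
    qed
    finally show ?thesis using S(2)[OF u(1), of p] \<epsilon>_le[of "f u $ p"]
      by (simp add: G_def matrix_vector_mult_split_diagonal algebra_simps)
  qed
  ultimately have "\<epsilon> * (x c - x s) $ p \<le> \<phi> c - \<phi> s"
    by (rule has_integral_le_off_negligible)
  then have "\<eta> s $ p < \<epsilon> * x s $ p" using less \<epsilon>(2) by (simp add: algebra_simps)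
  then show False using before[of s p] s \<epsilon>_le[of "x s $ p"] by linarith
qed

section \<open>Turning strictness into a gap\<close>

text \<open>
  A Metzler matrix becomes nonnegative after adding a large multiple of the identity.
\<close>

lemma metzler_shift_nonneg:
  fixes M :: "real^'n^'n"
  assumes "metzler M" "\<And>r. - l \<le> M $ r $ r" "\<And>q. 0 \<le> v $ q"
  shows "0 \<le> l * v $ r + (M *v v) $ r"
proof -
  have "0 \<le> (l + M $ r $ r) * v $ r" using assms(2)[of r] assms(3)[of r] by simp
  moreover have "0 \<le> (\<Sum>q\<in>UNIV-{r}. M $ r $ q * v $ q)"
    using assms(1,3) by (intro sum_nonneg mult_nonneg_nonneg) (auto simp: metzler_def)
  ultimately show ?thesis
    by (simp add: matrix_vector_mult_split_diagonal algebra_simps)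
qed

text \<open>
  With \<open>V\<close> the integral of the slack \<open>d - M *v \<xi>\<close>, one has \<open>V 0 = 0\<close> and \<open>V > 0\<close> afterwards. Subtracting
  \<open>\<kappa> *\<^sub>R V\<close> costs \<open>\<kappa> *\<^sub>R (d - M *v \<xi>)\<close> of the slack, which is affordable for \<open>\<kappa> < 1\<close>, and changes the
  remaining terms by \<open>\<kappa> *\<^sub>R (M *v V) - \<kappa>' *\<^sub>R V\<close>. The choice \<open>\<kappa>' = - l * \<kappa>\<close> with \<open>l *\<^sub>R mat 1 + M\<close>
  nonnegative gives this term the right sign.
\<close>

lemma supersolution_with_end_gap:
  fixes M :: "real \<Rightarrow> real^'n^'n" and \<xi> d :: "real \<Rightarrow> real^'n"
  assumes T: "0 < T"
    and M: "continuous_on {0..T} M" "\<And>s. s \<in> {0..T} \<Longrightarrow> metzler (M s)"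
    and \<xi>: "\<And>s. s \<in> {0..T} \<Longrightarrow> (\<xi> has_vector_derivative d s) (at s within {0..T})"
    and strict: "\<And>s r. s \<in> {0..T} \<Longrightarrow> (M s *v \<xi> s) $ r < d s $ r"
  obtains \<eta> d' where "\<eta> 0 = \<xi> 0" "\<And>r. \<eta> T $ r < \<xi> T $ r"
    "\<And>s r. s \<in> {0..T} \<Longrightarrow> \<eta> s $ r \<le> \<xi> s $ r"
    "\<And>s. s \<in> {0..T} \<Longrightarrow> (\<eta> has_vector_derivative d' s) (at s within {0..T})"
    "\<And>s r. s \<in> {0..T} \<Longrightarrow> (M s *v \<eta> s) $ r < d' s $ r"
proof -
  have "bounded (M ` {0..T})"
    using M(1) by (intro compact_imp_bounded compact_continuous_image) auto
  then obtain l where "l > 0" and "\<And>s. s \<in> {0..T} \<Longrightarrow> norm (M s) \<le> l"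
    by (auto simp: bounded_pos)
  then have l: "0 \<le> l" "\<And>s r. s \<in> {0..T} \<Longrightarrow> - l \<le> M s $ r $ r"
    by (simp, smt (verit, best) component_le_norm_cart Finite_Cartesian_Product.norm_nth_le)
  have \<xi>_cont: "continuous_on {0..T} \<xi>"
    using \<xi> by (rule continuous_on_vector_derivative)
  then have M\<xi>: "continuous_on {0..T} (\<lambda>s. M s *v \<xi> s)"
    using M(1) by (intro continuous_intros)
  define V where "V s = \<xi> s - \<xi> 0 - integral {0..s} (\<lambda>s. M s *v \<xi> s)" for s
  have V: "(V has_vector_derivative (d s - M s *v \<xi> s)) (at s within {0..T})" if "s \<in> {0..T}" for s
    unfolding V_def using that
    by (auto intro!: derivative_eq_intros \<xi> integral_has_vector_derivative[OF M\<xi>])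
  have V0: "V 0 = 0" by (simp add: V_def)
  have V_pos: "0 < V s $ r" if "s \<in> {0<..T}" for s r
  proof -
    have "\<exists>u\<in>{0<..<s}. V s $ r - V 0 $ r = (d u - M u *v \<xi> u) $ r * (s - 0)"
    proof (rule mvt_simple)
      fix u assume u: "0 \<le> u" "u \<le> s"
      then have "(V has_vector_derivative (d u - M u *v \<xi> u)) (at u within {0..s})"
        using V[of u] that by (auto elim: has_vector_derivative_within_subset)
      from bounded_linear.has_vector_derivative[OF bounded_linear_vec_nth this, of r]
      show "((\<lambda>s. V s $ r) has_derivative (*) ((d u - M u *v \<xi> u) $ r)) (at u within {0..s})"
        by (simp add: has_real_derivative_iff_has_vector_derivative[symmetric] has_field_derivative_def)
    qed (use that in auto)
    then obtain u where "u \<in> {0<..<s}" "V s $ r = (d u - M u *v \<xi> u) $ r * s"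
      using V0 by auto
    then show ?thesis using strict[of u r] that by simp
  qed
  then have V_nonneg: "0 \<le> V s $ r" if "s \<in> {0..T}" for s r
    using that V0 by (cases "s = 0") (auto simp: less_imp_le)
  define \<kappa> where "\<kappa> s = exp (- l * s) / 2" for s
  have \<kappa>: "0 < \<kappa> s" "s \<in> {0..T} \<Longrightarrow> \<kappa> s < 1" for s
    using l(1) by (auto simp: \<kappa>_def mult_nonneg_nonneg intro!: order.strict_trans1[of "exp _" 1])
  have \<kappa>': "(\<kappa> has_real_derivative - l * \<kappa> s) (at s within {0..T})" for s
    unfolding \<kappa>_def by (auto intro!: derivative_eq_intros)
  show ?thesis
  proof (rule that[of "\<lambda>s. \<xi> s - \<kappa> s *\<^sub>R V s"
        "\<lambda>s. d s - (\<kappa> s *\<^sub>R (d s - M s *v \<xi> s) + (- l * \<kappa> s) *\<^sub>R V s)"])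
    show "\<xi> 0 - \<kappa> 0 *\<^sub>R V 0 = \<xi> 0" by (simp add: V0)
    show "(\<xi> T - \<kappa> T *\<^sub>R V T) $ r < \<xi> T $ r" for r
      using V_pos[of T r] \<kappa>(1)[of T] T by simp
  next
    fix s assume s: "s \<in> {0..T}"
    show "(\<xi> s - \<kappa> s *\<^sub>R V s) $ r \<le> \<xi> s $ r" for r
      using V_nonneg[OF s, of r] \<kappa>(1)[of s] by simp
    show "((\<lambda>s. \<xi> s - \<kappa> s *\<^sub>R V s) has_vector_derivative
        d s - (\<kappa> s *\<^sub>R (d s - M s *v \<xi> s) + (- l * \<kappa> s) *\<^sub>R V s)) (at s within {0..T})"
      by (intro has_vector_derivative_diff has_vector_derivative_scaleR \<xi> \<kappa>' V s)
    fix r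
    have "0 < (1 - \<kappa> s) * (d s $ r - (M s *v \<xi> s) $ r)"
      using strict[OF s, of r] \<kappa>(2)[OF s] by simp
    moreover have "0 \<le> \<kappa> s * (l * V s $ r + (M s *v V s) $ r)"
      using metzler_shift_nonneg[OF M(2)[OF s] l(2)[OF s] V_nonneg[OF s], of r] \<kappa>(1)[of s] by simp
    ultimately show "(M s *v (\<xi> s - \<kappa> s *\<^sub>R V s)) $ r
        < (d s - (\<kappa> s *\<^sub>R (d s - M s *v \<xi> s) + (- l * \<kappa> s) *\<^sub>R V s)) $ r"
      by (simp add: matrix_vector_mult_diff_distrib matrix_vector_mult_scaleR algebra_simps)
  qed
qed

section \<open>Phases of a dwell-time signal\<close>

lemma dwell_switch_time_ge:
  assumes "dwell_signal Tb N t \<sigma>"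
  shows "ereal (real k * Tb) \<le> t k"
proof (induction k)
  case 0
  then show ?case using assms by (simp add: dwell_signal_def zero_ereal_def)
next
  case (Suc k)
  have "ereal (real (Suc k) * Tb) = ereal (real k * Tb) + ereal Tb"
    by (simp add: algebra_simps)
  also have "\<dots> \<le> t k + ereal Tb" by (intro add_right_mono Suc.IH)
  also have "\<dots> \<le> t (Suc k)" using assms by (simp add: dwell_signal_def)
  finally show ?case .
qed

lemma dwell_switch_time_finite:
  assumes "dwell_signal Tb N t \<sigma>" "Tb > 0" "t k < \<infinity>"
  shows "t k = ereal (real_of_ereal (t k))" "0 \<le> real_of_ereal (t k)"
proof -
  have "0 \<le> real k * Tb" using assms(2) by simp
  then have "0 \<le> t k" using dwell_switch_time_ge[OF assms(1), of k]
    by (meson ereal_less_eq(5) order_trans)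
  then show "t k = ereal (real_of_ereal (t k))" "0 \<le> real_of_ereal (t k)"
    using assms(3) by (auto simp: ereal_real real_of_ereal_pos)
qed

text \<open>
  The switching time itself still belongs to the previous mode, so the mode of a phase is sampled at
  an interior or end point: \<open>t k + Tb\<close> always lies in the half-open phase.
\<close>

definition phase_mode :: "real \<Rightarrow> (nat \<Rightarrow> ereal) \<Rightarrow> (real \<Rightarrow> nat) \<Rightarrow> nat \<Rightarrow> nat" where
  "phase_mode Tb t \<sigma> k = \<sigma> (real_of_ereal (t k) + Tb)"

lemma in_phase_mono: "in_phase t k \<tau> \<Longrightarrow> 0 < s \<Longrightarrow> s \<le> \<tau> \<Longrightarrow> in_phase t k s"
  unfolding in_phase_def by (meson add_left_mono ereal_less_eq(3) order_trans)

lemma in_phase_dwell: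
  "dwell_signal Tb N t \<sigma> \<Longrightarrow> Tb > 0 \<Longrightarrow> t k < \<infinity> \<Longrightarrow> in_phase t k Tb"
  by (simp add: in_phase_def dwell_signal_def)

lemma in_phase_mode:
  assumes "dwell_signal Tb N t \<sigma>" "Tb > 0" "in_phase t k \<tau>"
  shows "\<sigma> (real_of_ereal (t k) + \<tau>) = phase_mode Tb t \<sigma> k"
proof -
  have tk: "t k < \<infinity>" using assms(3) by (simp add: in_phase_def)
  then obtain a where a: "t k = ereal a"
    using dwell_switch_time_finite(1)[OF assms(1,2)] by metis
  have mem: "real_of_ereal (t k) + s \<in> {s. t k < ereal s \<and> ereal s \<le> t (Suc k)}"
    if "in_phase t k s" for s
    using that a by (simp add: in_phase_def)
  obtain i where "\<And>s. s \<in> {s. t k < ereal s \<and> ereal s \<le> t (Suc k)} \<Longrightarrow> \<sigma> s = i"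
    using assms(1) unfolding dwell_signal_def constant_on_def by meson
  then show ?thesis
    unfolding phase_mode_def using mem assms(3) in_phase_dwell[OF assms(1,2) tk] by metis
qed

lemma phase_mode_in_modes:
  assumes "dwell_signal Tb N t \<sigma>" "Tb > 0" "t k < \<infinity>"
  shows "phase_mode Tb t \<sigma> k \<in> {1..N}"
  using assms dwell_switch_time_finite(2)[OF assms] unfolding dwell_signal_def phase_mode_def by simp

lemma in_phase_last:
  assumes "dwell_signal Tb N t \<sigma>" "Tb > 0" "t (Suc k) < \<infinity>"
  defines "T \<equiv> real_of_ereal (t (Suc k)) - real_of_ereal (t k)"
  shows "t k < \<infinity>" "in_phase t k T" "Tb \<le> T"
proof -
  have le: "t k + ereal Tb \<le> t (Suc k)" using assms(1) by (simp add: dwell_signal_def)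
  then show tk: "t k < \<infinity>" using assms(3) by (cases "t k") auto
  obtain a b where ab: "t k = ereal a" "t (Suc k) = ereal b"
    using dwell_switch_time_finite(1)[OF assms(1,2)] tk assms(3) by metis
  then show "in_phase t k T" "Tb \<le> T" using le assms(2) by (auto simp: T_def in_phase_def)
qed

lemma phase_mode_changes:
  assumes "dwell_signal Tb N t \<sigma>" "Tb > 0" "t (Suc k) < \<infinity>"
  shows "phase_mode Tb t \<sigma> k \<noteq> phase_mode Tb t \<sigma> (Suc k)"
proof -
  have "phase_mode Tb t \<sigma> k = \<sigma> (real_of_ereal (t (Suc k)))"
    using in_phase_mode[OF assms(1,2) in_phase_last(2)[OF assms]] by simp
  moreover have "\<sigma> (real_of_ereal (t (Suc k)) + Tb) \<noteq> \<sigma> (real_of_ereal (t (Suc k)))"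
  proof -
    obtain a where a: "t (Suc k) = ereal a"
      using dwell_switch_time_finite(1)[OF assms] by metis
    then have "t (Suc k) < ereal (real_of_ereal (t (Suc k)) + Tb)"
      using assms(2) by simp
    moreover have "ereal (real_of_ereal (t (Suc k)) + Tb) \<le> t (Suc (Suc k))"
      using in_phase_dwell[OF assms] a by (simp add: in_phase_def)
    ultimately show ?thesis using assms(1) unfolding dwell_signal_def by blast
  qed
  ultimately show ?thesis by (simp add: phase_mode_def)
qed

lemma time_in_some_phase:
  assumes "dwell_signal Tb N t \<sigma>" "Tb > 0" "s > 0"
  obtains k \<tau> where "in_phase t k \<tau>" "s = real_of_ereal (t k) + \<tau>"
proof -
  obtain n where "s < real n * Tb" using reals_Archimedean3[OF assms(2)] by auto
  then have n: "ereal s \<le> t n"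
    using order_trans[OF _ dwell_switch_time_ge[OF assms(1), of n], of "ereal s"] by simp
  obtain m where m: "ereal s \<le> t m" "\<And>k. k < m \<Longrightarrow> t k < ereal s"
    using ex_least_nat_le[of "\<lambda>n. ereal s \<le> t n", OF n] by (metis not_le)
  have "m \<noteq> 0"
    using m(1) assms(1,3) by (intro notI) (simp add: dwell_signal_def)
  then obtain k where k: "m = Suc k" by (cases m) auto
  have tk: "t k < ereal s" "ereal s \<le> t (Suc k)" using m k by auto
  then have "t k < \<infinity>" by (cases "t k") auto
  then obtain a where a: "t k = ereal a"
    using dwell_switch_time_finite(1)[OF assms(1,2)] by metis
  show ?thesis
  proof (rule that)
    show "in_phase t k (s - real_of_ereal (t k))"
      using tk a by (simp add: in_phase_def)
  qed simp
qed

text \<open>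
  \<open>P k\<close> is what is known on entering phase \<open>k\<close> and \<open>Q k\<close> what is known along it; a last phase of
  infinite length is covered.
\<close>

lemma phase_induction:
  assumes "dwell_signal Tb N t \<sigma>" "Tb > 0"
    and start: "P 0"
    and flow: "\<And>k \<tau>. in_phase t k \<tau> \<Longrightarrow> P k \<Longrightarrow> Q k \<tau>"
    and switch: "\<And>k. t (Suc k) < \<infinity> \<Longrightarrow>
        Q k (real_of_ereal (t (Suc k)) - real_of_ereal (t k)) \<Longrightarrow> P (Suc k)"
    and "in_phase t k \<tau>"
  shows "Q k \<tau>"
proof -
  have "P k" if "t k < \<infinity>" for k
    using that
  proof (induction k)
    case (Suc k)
    then show ?case using in_phase_last[OF assms(1,2) Suc.prems] flow switch by blast
  qed (rule start)
  then show ?thesis using flow assms(6) by (simp add: in_phase_def)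
qed

section \<open>Certificates\<close>

definition phase_solution ::
  "(real \<Rightarrow> real^'n^'n) \<Rightarrow> real \<Rightarrow> (real \<Rightarrow> real^'n) \<Rightarrow> (real \<Rightarrow> real^'n) \<Rightarrow> bool" where
  "phase_solution M T f y \<longleftrightarrow> continuous_on {0..T} y \<and>
     (\<forall>s\<in>{0..T}. ((\<lambda>s. M s *v y s + f s) has_integral (y s - y 0)) {0..s})"

text \<open>
  A solution whose dynamics depend on the phase only through its mode \<open>\<kappa> k\<close>. The forcing \<open>f k\<close> is a
  function of the time elapsed in the phase.
\<close>

definition dwell_trajectory ::
  "(nat \<Rightarrow> real \<Rightarrow> real^'n^'n) \<Rightarrow> (nat \<Rightarrow> nat) \<Rightarrow> (nat \<Rightarrow> ereal) \<Rightarrow>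
   (nat \<Rightarrow> real \<Rightarrow> real^'n) \<Rightarrow> (real \<Rightarrow> real^'n) \<Rightarrow> bool" where
  "dwell_trajectory M \<kappa> t f x \<longleftrightarrow> continuous_on {0..} x \<and>
     (\<forall>k \<tau>. in_phase t k \<tau> \<longrightarrow>
        ((\<lambda>s. M (\<kappa> k) s *v x (real_of_ereal (t k) + s) + f k s)
          has_integral (x (real_of_ereal (t k) + \<tau>) - x (real_of_ereal (t k)))) {0..\<tau>})"

lemma dwell_trajectory_phase:
  assumes "dwell_signal Tb N t \<sigma>" "Tb > 0" "dwell_trajectory M \<kappa> t f x" "in_phase t k \<tau>"
  shows "phase_solution (M (\<kappa> k)) \<tau> (f k) (\<lambda>s. x (real_of_ereal (t k) + s))"
  unfolding phase_solution_def
proof (intro conjI ballI)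
  have "0 \<le> real_of_ereal (t k)"
    using dwell_switch_time_finite(2)[OF assms(1,2)] assms(4) by (simp add: in_phase_def)
  then show "continuous_on {0..\<tau>} (\<lambda>s. x (real_of_ereal (t k) + s))"
    using assms(3) unfolding dwell_trajectory_def
    by (auto intro!: continuous_on_compose2[of "{0..}" x] continuous_intros)
  fix s assume s: "s \<in> {0..\<tau>}"
  show "((\<lambda>s. M (\<kappa> k) s *v x (real_of_ereal (t k) + s) + f k s) has_integral
      x (real_of_ereal (t k) + s) - x (real_of_ereal (t k) + 0)) {0..s}"
  proof (cases "s = 0")
    case False
    then have "in_phase t k s" using in_phase_mono[OF assms(4)] s by simp
    then show ?thesis using assms(3) unfolding dwell_trajectory_def by simp
  qed (simp add: has_integral_refl)
qed

text \<open>
  The box is governed by differential inequalities of different nature before and after the dwell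
  time \<open>c\<close>; the second box may start with a jump upwards.
\<close>

lemma two_stage_comparison:
  fixes M :: "real \<Rightarrow> real^'n^'n" and f g y \<eta>\<^sub>1 \<eta>\<^sub>2 d\<^sub>1 d\<^sub>2 :: "real \<Rightarrow> real^'n"
  assumes c: "0 \<le> c"
    and M: "continuous_on {0..} M" "\<And>s. 0 \<le> s \<Longrightarrow> metzler (M s)"
    and g: "continuous_on {0..} g"
    and S: "negligible S" "\<And>s r. s \<in> {0..T} - S \<Longrightarrow> \<bar>f s $ r\<bar> \<le> g s $ r"
    and y: "phase_solution M T f y"
    and \<eta>\<^sub>1: "\<And>s. s \<in> {0..c} \<Longrightarrow> (\<eta>\<^sub>1 has_vector_derivative d\<^sub>1 s) (at s within {0..c})"
      "\<And>s r. s \<in> {0..c} \<Longrightarrow> (M s *v \<eta>\<^sub>1 s + g s) $ r < d\<^sub>1 s $ r"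
    and \<eta>\<^sub>2: "\<And>s. s \<ge> c \<Longrightarrow> (\<eta>\<^sub>2 has_vector_derivative d\<^sub>2 s) (at s)"
      "\<And>s r. s \<ge> c \<Longrightarrow> (M s *v \<eta>\<^sub>2 s + g s) $ r < d\<^sub>2 s $ r"
    and join: "\<And>r. \<eta>\<^sub>1 c $ r \<le> \<eta>\<^sub>2 c $ r"
    and init: "\<And>r. \<bar>y 0 $ r\<bar> < \<eta>\<^sub>1 0 $ r"
    and \<tau>: "\<tau> \<in> {0..T}"
  shows "\<bar>y \<tau> $ r\<bar> < (if \<tau> \<le> c then \<eta>\<^sub>1 \<tau> else \<eta>\<^sub>2 \<tau>) $ r"
proof -
  have ycont: "continuous_on {0..T} y"
    and yint: "\<And>s. s \<in> {0..T} \<Longrightarrow> ((\<lambda>s. M s *v y s + f s) has_integral (y s - y 0)) {0..s}"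
    using y unfolding phase_solution_def by blast+
  have stage1: "\<bar>y s $ r\<bar> < \<eta>\<^sub>1 s $ r" if s: "s \<in> {0..T}" "s \<le> c" for s r
  proof (rule positive_comparison[where M = M and f = f and g = g and x = y and a = 0 and b = s and \<eta> = \<eta>\<^sub>1 and d = d\<^sub>1 and S = S])
    show "continuous_on {0..s} \<eta>\<^sub>1"
      by (rule continuous_on_subset[OF continuous_on_vector_derivative[OF \<eta>\<^sub>1(1)]]) (use s in auto)
    show "(\<eta>\<^sub>1 has_vector_derivative d\<^sub>1 u) (at u within {0..u})" if "u \<in> {0<..s}" for u
      by (rule has_vector_derivative_within_subset[OF \<eta>\<^sub>1(1)]) (use that s in auto)
  qed (use s M g S yint ycont \<eta>\<^sub>1(2) init in \<open>auto intro: continuous_on_subset\<close>)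
  show ?thesis
  proof (cases "\<tau> \<le> c")
    case False
    have "\<bar>y \<tau> $ r\<bar> < \<eta>\<^sub>2 \<tau> $ r"
    proof (rule positive_comparison[where M = M and f = f and g = g and x = y and a = c and b = \<tau> and \<eta> = \<eta>\<^sub>2 and d = d\<^sub>2 and S = S])
      show "continuous_on {c..\<tau>} \<eta>\<^sub>2"
        by (rule continuous_on_vector_derivative[of _ _ d\<^sub>2])
          (use \<eta>\<^sub>2(1) in \<open>auto intro: has_vector_derivative_at_within\<close>)
      show "(\<eta>\<^sub>2 has_vector_derivative d\<^sub>2 u) (at u within {c..u})" if "u \<in> {c<..\<tau>}" for u
        by (rule has_vector_derivative_at_within[OF \<eta>\<^sub>2(1)]) (use that in auto)
      show "((\<lambda>s. M s *v y s + f s) has_integral y s - y c) {c..s}" if "s \<in> {c..\<tau>}" for s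
        by (rule has_integral_increment[OF yint]) (use that \<tau> c in auto)
      show "\<bar>y c $ r\<bar> < \<eta>\<^sub>2 c $ r" for r
        using stage1[of c r] join[of r] False c \<tau> by auto
    qed (use c False \<tau> M g S ycont \<eta>\<^sub>2(2) in \<open>auto intro: continuous_on_subset\<close>)
    then show ?thesis using False by simp
  qed (use stage1 \<tau> in simp)
qed

text \<open>
  The data left once the controller has been inserted: \<open>M\<close> is the closed loop, \<open>e\<close> bounds the forcing by
  disturbances of size \<open>1\<close>, and \<open>\<xi>\<close> is the box.
\<close>

locale dwell_certificate =
  fixes Tb :: real and N :: nat
    and M :: "nat \<Rightarrow> real \<Rightarrow> real^'n^'n"
    and e \<xi> \<xi>' :: "nat \<Rightarrow> real \<Rightarrow> real^'n"
  assumes Tb_pos: "Tb > 0"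
    and M_cont: "\<And>i. i \<in> {1..N} \<Longrightarrow> continuous_on {0..} (M i)"
    and M_metzler: "\<And>i s. i \<in> {1..N} \<Longrightarrow> 0 \<le> s \<Longrightarrow> metzler (M i s)"
    and M_idle: "\<And>i s. i \<in> {1..N} \<Longrightarrow> Tb \<le> s \<Longrightarrow> M i s = M i Tb"
    and e_cont: "\<And>i. i \<in> {1..N} \<Longrightarrow> continuous_on {0..} (e i)"
    and e_nonneg: "\<And>i s r. i \<in> {1..N} \<Longrightarrow> 0 \<le> s \<Longrightarrow> 0 \<le> e i s $ r"
    and e_idle: "\<And>i s. i \<in> {1..N} \<Longrightarrow> Tb \<le> s \<Longrightarrow> e i s = e i Tb"
    and \<xi>_pos: "\<And>i s r. i \<in> {1..N} \<Longrightarrow> s \<in> {0..Tb} \<Longrightarrow> 0 < \<xi> i s $ r"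
    and \<xi>_deriv: "\<And>i s. i \<in> {1..N} \<Longrightarrow> s \<in> {0..Tb} \<Longrightarrow>
          (\<xi> i has_vector_derivative \<xi>' i s) (at s within {0..Tb})"
    and \<xi>_flow: "\<And>i s r. i \<in> {1..N} \<Longrightarrow> s \<in> {0..Tb} \<Longrightarrow> (M i s *v \<xi> i s + e i s) $ r < \<xi>' i s $ r"
    and \<xi>_idle: "\<And>i r. i \<in> {1..N} \<Longrightarrow> (M i Tb *v \<xi> i Tb + e i Tb) $ r < 0"
    and \<xi>_switch: "\<And>i j r. i \<in> {1..N} \<Longrightarrow> j \<in> {1..N} \<Longrightarrow> i \<noteq> j \<Longrightarrow> \<xi> i Tb $ r \<le> \<xi> j 0 $ r"
begin

lemma forced_phase_bound:
  assumes i: "i \<in> {1..N}"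
    and S: "negligible S" "\<And>s r. s \<in> {0..T} - S \<Longrightarrow> \<bar>f s $ r\<bar> \<le> e i s $ r"
    and y: "phase_solution (M i) T f y" and init: "\<And>r. \<bar>y 0 $ r\<bar> < \<xi> i 0 $ r"
    and \<tau>: "\<tau> \<in> {0..T}"
  shows "\<bar>y \<tau> $ r\<bar> < \<xi> i (min \<tau> Tb) $ r"
proof -
  have "\<bar>y \<tau> $ r\<bar> < (if \<tau> \<le> Tb then \<xi> i \<tau> else \<xi> i Tb) $ r"
  proof (rule two_stage_comparison[where \<eta>\<^sub>2 = "\<lambda>_. \<xi> i Tb" and d\<^sub>2 = "\<lambda>_. 0", OF _ _ _ _ S y])
    show "(M i s *v \<xi> i Tb + e i s) $ r < 0 $ r" if "s \<ge> Tb" for s r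
      using \<xi>_idle[OF i, of r] M_idle[OF i that] e_idle[OF i that] by simp
  qed (use Tb_pos M_cont[OF i] M_metzler[OF i] e_cont[OF i] \<xi>_deriv[OF i] \<xi>_flow[OF i] init \<tau> in auto)
  then show ?thesis by (cases "\<tau> \<le> Tb") (simp_all add: min_def)
qed

text \<open>
  Before the dwell time the state is only known to stay in the scaled box; the decay becomes visible at
  the dwell time, where the gap is spent. The same \<open>\<beta>\<close> serves all modes because there are finitely many.
  The two bounds are both available at \<open>\<tau> = Tb\<close>, where a phase may end.
\<close>

lemma unforced_phase_bound:
  obtains \<beta> where "0 < \<beta>"
    and "\<And>i c T y \<tau> r. i \<in> {1..N} \<Longrightarrow> 0 < c \<Longrightarrow> phase_solution (M i) T (\<lambda>_. 0) y \<Longrightarrow>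
      (\<And>r. \<bar>y 0 $ r\<bar> < c * \<xi> i 0 $ r) \<Longrightarrow> \<tau> \<in> {0..T} \<Longrightarrow>
      (\<tau> \<le> Tb \<longrightarrow> \<bar>y \<tau> $ r\<bar> < c * \<xi> i \<tau> $ r) \<and>
      (Tb \<le> \<tau> \<longrightarrow> \<bar>y \<tau> $ r\<bar> < c * exp (- \<beta> * \<tau>) * \<xi> i Tb $ r)"
proof -
  define Q where "Q i \<eta> d \<longleftrightarrow> \<eta> 0 = \<xi> i 0 \<and> (\<forall>r. \<eta> Tb $ r < \<xi> i Tb $ r) \<and>
      (\<forall>s\<in>{0..Tb}. \<forall>r. \<eta> s $ r \<le> \<xi> i s $ r) \<and>
      (\<forall>s\<in>{0..Tb}. (\<eta> has_vector_derivative d s) (at s within {0..Tb})) \<and>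
      (\<forall>s\<in>{0..Tb}. \<forall>r. (M i s *v \<eta> s) $ r < d s $ r)" for i \<eta> d
  have "\<exists>\<eta> d. Q i \<eta> d" if i: "i \<in> {1..N}" for i
  proof -
    have flow: "(M i s *v \<xi> i s) $ r < \<xi>' i s $ r" if "s \<in> {0..Tb}" for s r
      using \<xi>_flow[OF i that, of r] e_nonneg[OF i, of s r] that by simp
    have cont: "continuous_on {0..Tb} (M i)"
      using M_cont[OF i] by (rule continuous_on_subset) auto
    have "metzler (M i s)" if "s \<in> {0..Tb}" for s
      using M_metzler[OF i] that by simp
    from supersolution_with_end_gap[OF Tb_pos cont this \<xi>_deriv[OF i] flow]
    obtain \<eta> d where "\<eta> 0 = \<xi> i 0" "\<And>r. \<eta> Tb $ r < \<xi> i Tb $ r"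
      "\<And>s r. s \<in> {0..Tb} \<Longrightarrow> \<eta> s $ r \<le> \<xi> i s $ r"
      "\<And>s. s \<in> {0..Tb} \<Longrightarrow> (\<eta> has_vector_derivative d s) (at s within {0..Tb})"
      "\<And>s r. s \<in> {0..Tb} \<Longrightarrow> (M i s *v \<eta> s) $ r < d s $ r"
      by metis
    then have "Q i \<eta> d" unfolding Q_def by (intro conjI ballI allI)
    then show ?thesis by blast
  qed
  then obtain \<eta> d where Q: "\<And>i. i \<in> {1..N} \<Longrightarrow> Q i (\<eta> i) (d i)"
    by metis
  have \<eta>: "\<And>i. i \<in> {1..N} \<Longrightarrow> \<eta> i 0 = \<xi> i 0"
    "\<And>i r. i \<in> {1..N} \<Longrightarrow> \<eta> i Tb $ r < \<xi> i Tb $ r"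
    "\<And>i s r. i \<in> {1..N} \<Longrightarrow> s \<in> {0..Tb} \<Longrightarrow> \<eta> i s $ r \<le> \<xi> i s $ r"
    "\<And>i s. i \<in> {1..N} \<Longrightarrow> s \<in> {0..Tb} \<Longrightarrow> (\<eta> i has_vector_derivative d i s) (at s within {0..Tb})"
    "\<And>i s r. i \<in> {1..N} \<Longrightarrow> s \<in> {0..Tb} \<Longrightarrow> (M i s *v \<eta> i s) $ r < d i s $ r"
    using Q unfolding Q_def by blast+
  (* Both inequalities are strict at rate 0, hence survive for small positive rates. *)
  have "\<forall>\<^sub>F \<beta> in at_right 0. \<forall>i\<in>{1..N}. \<forall>r\<in>UNIV. \<eta> i Tb $ r < exp (- \<beta> * Tb) * \<xi> i Tb $ r \<and>
      (M i Tb *v \<xi> i Tb) $ r < - \<beta> * \<xi> i Tb $ r"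
  proof (intro eventually_ball_finite ballI eventually_conj)
    fix i r assume i: "i \<in> {1..N}"
    have "((\<lambda>\<beta>. exp (- \<beta> * Tb) * \<xi> i Tb $ r) \<longlongrightarrow> exp (- 0 * Tb) * \<xi> i Tb $ r) (at_right 0)"
      by (intro tendsto_intros)
    then show "\<forall>\<^sub>F \<beta> in at_right 0. \<eta> i Tb $ r < exp (- \<beta> * Tb) * \<xi> i Tb $ r"
      using \<eta>(2)[OF i, of r] by (intro order_tendstoD(1)) auto
    have "((\<lambda>\<beta>. - \<beta> * \<xi> i Tb $ r) \<longlongrightarrow> - 0 * \<xi> i Tb $ r) (at_right 0)"
      by (intro tendsto_intros)
    then show "\<forall>\<^sub>F \<beta> in at_right 0. (M i Tb *v \<xi> i Tb) $ r < - \<beta> * \<xi> i Tb $ r"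
      using \<xi>_idle[OF i, of r] e_nonneg[OF i, of Tb r] Tb_pos by (intro order_tendstoD(1)) auto
  qed auto
  then have "\<forall>\<^sub>F \<beta> in at_right (0::real). 0 < \<beta> \<and> (\<forall>i\<in>{1..N}. \<forall>r\<in>UNIV. \<eta> i Tb $ r < exp (- \<beta> * Tb) * \<xi> i Tb $ r \<and>
      (M i Tb *v \<xi> i Tb) $ r < - \<beta> * \<xi> i Tb $ r)"
    by (intro eventually_conj eventually_at_right_less)
  from eventually_happens'[OF trivial_limit_at_right_real this]
  obtain \<beta> :: real where \<beta>: "0 < \<beta>"
    "\<And>i r. i \<in> {1..N} \<Longrightarrow> \<eta> i Tb $ r < exp (- \<beta> * Tb) * \<xi> i Tb $ r"
    "\<And>i r. i \<in> {1..N} \<Longrightarrow> (M i Tb *v \<xi> i Tb) $ r < - \<beta> * \<xi> i Tb $ r"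
    by blast
  show ?thesis
  proof (rule that[OF \<beta>(1)])
    fix i and c T :: real and y \<tau> r
    assume i: "i \<in> {1..N}" and c: "0 < c" and y: "phase_solution (M i) T (\<lambda>_. 0) y"
      and init: "\<And>r. \<bar>y 0 $ r\<bar> < c * \<xi> i 0 $ r" and \<tau>: "\<tau> \<in> {0..T}"
    have *: "\<bar>y \<tau> $ r\<bar> < (if \<tau> \<le> Tb then c *\<^sub>R \<eta> i \<tau> else (c * exp (- \<beta> * \<tau>)) *\<^sub>R \<xi> i Tb) $ r"
    proof (rule two_stage_comparison[where g = "\<lambda>_. 0" and S = "{}" and d\<^sub>1 = "\<lambda>s. c *\<^sub>R d i s" and
          \<eta>\<^sub>2 = "\<lambda>s. (c * exp (- \<beta> * s)) *\<^sub>R \<xi> i Tb" and d\<^sub>2 = "\<lambda>s. (- \<beta> * (c * exp (- \<beta> * s))) *\<^sub>R \<xi> i Tb",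
          OF _ _ _ _ _ _ y])
      show "((\<lambda>s. c *\<^sub>R \<eta> i s) has_vector_derivative c *\<^sub>R d i s) (at s within {0..Tb})"
        if "s \<in> {0..Tb}" for s
        using \<eta>(4)[OF i that] by (rule has_vector_derivative_scaleR[OF DERIV_const, simplified])
      show "(M i s *v c *\<^sub>R \<eta> i s + 0) $ r < (c *\<^sub>R d i s) $ r" if "s \<in> {0..Tb}" for s r
        using \<eta>(5)[OF i that] c by (simp add: matrix_vector_mult_scaleR)
      show "((\<lambda>s. (c * exp (- \<beta> * s)) *\<^sub>R \<xi> i Tb) has_vector_derivative
          (- \<beta> * (c * exp (- \<beta> * s))) *\<^sub>R \<xi> i Tb) (at s)" for s
        by (auto intro!: derivative_eq_intros)
      show "(M i s *v (c * exp (- \<beta> * s)) *\<^sub>R \<xi> i Tb + 0) $ r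
          < ((- \<beta> * (c * exp (- \<beta> * s))) *\<^sub>R \<xi> i Tb) $ r" if "s \<ge> Tb" for s r
        using \<beta>(3)[OF i, of r] c M_idle[OF i that]
          mult_strict_left_mono[of "(M i Tb *v \<xi> i Tb) $ r" "- \<beta> * \<xi> i Tb $ r" "c * exp (- \<beta> * s)"]
        by (simp add: matrix_vector_mult_scaleR mult_ac)
      show "(c *\<^sub>R \<eta> i Tb) $ r \<le> ((c * exp (- \<beta> * Tb)) *\<^sub>R \<xi> i Tb) $ r" for r
        using mult_left_mono[OF less_imp_le[OF \<beta>(2)[OF i, of r]], of c] c by (simp add: mult_ac)
    qed (use Tb_pos M_cont[OF i] M_metzler[OF i] \<eta>(1)[OF i] init \<tau> in auto)
    show "(\<tau> \<le> Tb \<longrightarrow> \<bar>y \<tau> $ r\<bar> < c * \<xi> i \<tau> $ r) \<and>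
      (Tb \<le> \<tau> \<longrightarrow> \<bar>y \<tau> $ r\<bar> < c * exp (- \<beta> * \<tau>) * \<xi> i Tb $ r)"
    proof (intro conjI impI)
      assume "\<tau> \<le> Tb"
      moreover have "c * \<eta> i \<tau> $ r \<le> c * \<xi> i \<tau> $ r"
        using \<eta>(3)[OF i, of \<tau> r] \<open>\<tau> \<le> Tb\<close> \<tau> c by simp
      ultimately show "\<bar>y \<tau> $ r\<bar> < c * \<xi> i \<tau> $ r" using * by simp
    next
      assume "Tb \<le> \<tau>"
      show "\<bar>y \<tau> $ r\<bar> < c * exp (- \<beta> * \<tau>) * \<xi> i Tb $ r"
      proof (cases "\<tau> = Tb")
        case True
        have "c * \<eta> i Tb $ r < c * (exp (- \<beta> * Tb) * \<xi> i Tb $ r)"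
          using \<beta>(2)[OF i, of r] c by (intro mult_strict_left_mono) auto
        then show ?thesis using * True by (simp add: mult_ac)
      qed (use * \<open>Tb \<le> \<tau>\<close> in simp)
    qed
  qed
qed

theorem forced_trajectory_bound:
  assumes \<sigma>: "dwell_signal Tb N t \<sigma>"
    and x: "dwell_trajectory M (phase_mode Tb t \<sigma>) t f x"
    and S: "\<And>k. t k < \<infinity> \<Longrightarrow> negligible (S k)"
      "\<And>k \<tau> s r. in_phase t k \<tau> \<Longrightarrow> s \<in> {0..\<tau>} - S k \<Longrightarrow> \<bar>f k s $ r\<bar> \<le> e (phase_mode Tb t \<sigma> k) s $ r"
    and init: "\<And>i r. i \<in> {1..N} \<Longrightarrow> \<bar>x 0 $ r\<bar> < \<xi> i 0 $ r"
    and "in_phase t k \<tau>"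
  shows "\<bar>x (real_of_ereal (t k) + \<tau>) $ r\<bar> < \<xi> (phase_mode Tb t \<sigma> k) (min \<tau> Tb) $ r"
proof -
  have "\<forall>r. \<bar>x (real_of_ereal (t k) + \<tau>) $ r\<bar> < \<xi> (phase_mode Tb t \<sigma> k) (min \<tau> Tb) $ r"
    using \<sigma> Tb_pos _ _ _ assms(6)
  proof (rule phase_induction[where P = "\<lambda>k. \<forall>r. \<bar>x (real_of_ereal (t k)) $ r\<bar> < \<xi> (phase_mode Tb t \<sigma> k) 0 $ r"])
    have t0: "t 0 = 0" using \<sigma> by (simp add: dwell_signal_def)
    then show "\<forall>r. \<bar>x (real_of_ereal (t 0)) $ r\<bar> < \<xi> (phase_mode Tb t \<sigma> 0) 0 $ r"
      using init phase_mode_in_modes[OF \<sigma> Tb_pos, of 0] by simp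
  next
    fix k \<tau>
    assume ph: "in_phase t k \<tau>" and P: "\<forall>r. \<bar>x (real_of_ereal (t k)) $ r\<bar> < \<xi> (phase_mode Tb t \<sigma> k) 0 $ r"
    have k: "t k < \<infinity>" "0 < \<tau>" using ph by (simp_all add: in_phase_def)
    show "\<forall>r. \<bar>x (real_of_ereal (t k) + \<tau>) $ r\<bar> < \<xi> (phase_mode Tb t \<sigma> k) (min \<tau> Tb) $ r"
    proof
      fix r
      show "\<bar>x (real_of_ereal (t k) + \<tau>) $ r\<bar> < \<xi> (phase_mode Tb t \<sigma> k) (min \<tau> Tb) $ r"
        by (rule forced_phase_bound[OF phase_mode_in_modes[OF \<sigma> Tb_pos k(1)] S(1)[OF k(1)] S(2)[OF ph]
              dwell_trajectory_phase[OF \<sigma> Tb_pos x ph]])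
          (use P k in auto)
    qed
  next
    fix k
    assume k: "t (Suc k) < \<infinity>"
    note last = in_phase_last[OF \<sigma> Tb_pos k]
    assume Q: "\<forall>r. \<bar>x (real_of_ereal (t k) + (real_of_ereal (t (Suc k)) - real_of_ereal (t k))) $ r\<bar>
      < \<xi> (phase_mode Tb t \<sigma> k) (min (real_of_ereal (t (Suc k)) - real_of_ereal (t k)) Tb) $ r"
    show "\<forall>r. \<bar>x (real_of_ereal (t (Suc k))) $ r\<bar> < \<xi> (phase_mode Tb t \<sigma> (Suc k)) 0 $ r"
    proof
      fix r
      have "\<bar>x (real_of_ereal (t (Suc k))) $ r\<bar> < \<xi> (phase_mode Tb t \<sigma> k) Tb $ r"
        using Q last(3) by (simp add: min_absorb2)
      also have "\<dots> \<le> \<xi> (phase_mode Tb t \<sigma> (Suc k)) 0 $ r"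
        by (intro \<xi>_switch phase_mode_in_modes[OF \<sigma> Tb_pos] phase_mode_changes[OF \<sigma> Tb_pos] k last(1))
      finally show "\<bar>x (real_of_ereal (t (Suc k))) $ r\<bar> < \<xi> (phase_mode Tb t \<sigma> (Suc k)) 0 $ r" .
    qed
  qed
  then show ?thesis by blast
qed

lemma certificate_bounds:
  obtains m R where "0 < m" "0 < R" "\<And>i r. i \<in> {1..N} \<Longrightarrow> m \<le> \<xi> i 0 $ r"
    "\<And>i s r. i \<in> {1..N} \<Longrightarrow> s \<in> {0..Tb} \<Longrightarrow> \<xi> i s $ r \<le> R"
proof -
  have "bounded (\<Union>i\<in>{1..N}. \<xi> i ` {0..Tb})"
    by (intro bounded_UN ballI compact_imp_bounded compact_continuous_image
        continuous_on_vector_derivative[OF \<xi>_deriv]) auto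
  then obtain R where "0 < R" and R: "\<forall>v\<in>(\<Union>i\<in>{1..N}. \<xi> i ` {0..Tb}). norm v \<le> R"
    by (auto simp: bounded_pos)
  have "\<xi> i s $ r \<le> R" if "i \<in> {1..N}" "s \<in> {0..Tb}" for i s r
    using R that component_le_norm_cart[of "\<xi> i s" r] by force
  moreover define m where "m = Min (insert 1 ((\<lambda>(i, r). \<xi> i 0 $ r) ` ({1..N} \<times> UNIV)))"
  have "0 < m" using \<xi>_pos[of _ 0] Tb_pos by (auto simp: m_def)
  moreover have "m \<le> \<xi> i 0 $ r" if "i \<in> {1..N}" for i r
    unfolding m_def by (rule Min_le) (use that in force)+
  ultimately show ?thesis using \<open>0 < R\<close> that by blast
qed

text \<open>
  The box entering phase \<open>k\<close> is scaled by \<open>c * exp (- \<beta> * t k)\<close>. A phase that has lasted \<open>\<tau> \<ge> Tb\<close> contributes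
  \<open>exp (- \<beta> * \<tau>)\<close>, and a younger one is at most \<open>Tb\<close> old, which is absorbed in the constant \<open>L\<close>.
\<close>

theorem unforced_trajectory_decay:
  obtains \<beta> m L where "0 < \<beta>" "0 < m" "0 < L"
    and "\<And>t \<sigma> x c s r. dwell_signal Tb N t \<sigma> \<Longrightarrow>
      dwell_trajectory M (phase_mode Tb t \<sigma>) t (\<lambda>_ _. 0) x \<Longrightarrow> 0 < c \<Longrightarrow>
      (\<And>r. \<bar>x 0 $ r\<bar> < c * m) \<Longrightarrow> 0 \<le> s \<Longrightarrow> \<bar>x s $ r\<bar> \<le> c * L * exp (- \<beta> * s)"
proof -
  obtain m R where m: "0 < m" "\<And>i r. i \<in> {1..N} \<Longrightarrow> m \<le> \<xi> i 0 $ r"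
    and R: "0 < R" "\<And>i s r. i \<in> {1..N} \<Longrightarrow> s \<in> {0..Tb} \<Longrightarrow> \<xi> i s $ r \<le> R"
    using certificate_bounds by metis
  obtain \<beta> where \<beta>: "0 < \<beta>" and bound:
    "\<And>i c T y \<tau> r. i \<in> {1..N} \<Longrightarrow> 0 < c \<Longrightarrow> phase_solution (M i) T (\<lambda>_. 0) y \<Longrightarrow>
      (\<And>r. \<bar>y 0 $ r\<bar> < c * \<xi> i 0 $ r) \<Longrightarrow> \<tau> \<in> {0..T} \<Longrightarrow>
      (\<tau> \<le> Tb \<longrightarrow> \<bar>y \<tau> $ r\<bar> < c * \<xi> i \<tau> $ r) \<and>
      (Tb \<le> \<tau> \<longrightarrow> \<bar>y \<tau> $ r\<bar> < c * exp (- \<beta> * \<tau>) * \<xi> i Tb $ r)"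
    by (rule unforced_phase_bound) blast
  define L where "L = R * exp (\<beta> * Tb)"
  have "0 < L" using R(1) by (simp add: L_def)
  show ?thesis
  proof (rule that[OF \<beta> m(1) \<open>0 < L\<close>])
    fix t \<sigma> x c s r
    assume \<sigma>: "dwell_signal Tb N t \<sigma>"
      and x: "dwell_trajectory M (phase_mode Tb t \<sigma>) t (\<lambda>_ _. 0) x"
      and c: "(0::real) < c" and init: "\<And>r. \<bar>x 0 $ r\<bar> < c * m" and s: "(0::real) \<le> s"
    let ?tk = "\<lambda>k. real_of_ereal (t k)" and ?i = "phase_mode Tb t \<sigma>"
    define C where "C k = c * exp (- \<beta> * ?tk k)" for k
    have C: "0 < C k" for k using c by (simp add: C_def)
    have t0: "t 0 = 0" using \<sigma> by (simp add: dwell_signal_def)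
    have mode: "?i k \<in> {1..N}" if "t k < \<infinity>" for k by (rule phase_mode_in_modes[OF \<sigma> Tb_pos that])
    have inv: "\<forall>r. (\<tau> \<le> Tb \<longrightarrow> \<bar>x (?tk k + \<tau>) $ r\<bar> < C k * \<xi> (?i k) \<tau> $ r) \<and>
        (Tb \<le> \<tau> \<longrightarrow> \<bar>x (?tk k + \<tau>) $ r\<bar> < C k * exp (- \<beta> * \<tau>) * \<xi> (?i k) Tb $ r)"
      if "in_phase t k \<tau>" for k \<tau>
      using \<sigma> Tb_pos _ _ _ that
    proof (rule phase_induction[where P = "\<lambda>k. \<forall>r. \<bar>x (?tk k) $ r\<bar> < C k * \<xi> (?i k) 0 $ r"])
      show "\<forall>r. \<bar>x (?tk 0) $ r\<bar> < C 0 * \<xi> (?i 0) 0 $ r"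
      proof
        fix r
        have "\<bar>x (?tk 0) $ r\<bar> < c * m" using init t0 by simp
        also have "\<dots> \<le> C 0 * \<xi> (?i 0) 0 $ r" using m(2)[OF mode, of 0 r] t0 c by (simp add: C_def)
        finally show "\<bar>x (?tk 0) $ r\<bar> < C 0 * \<xi> (?i 0) 0 $ r" .
      qed
    next
      fix k \<tau>
      assume ph: "in_phase t k \<tau>" and P: "\<forall>r. \<bar>x (?tk k) $ r\<bar> < C k * \<xi> (?i k) 0 $ r"
      have k: "t k < \<infinity>" "0 < \<tau>" using ph by (simp_all add: in_phase_def)
      show "\<forall>r. (\<tau> \<le> Tb \<longrightarrow> \<bar>x (?tk k + \<tau>) $ r\<bar> < C k * \<xi> (?i k) \<tau> $ r) \<and>
        (Tb \<le> \<tau> \<longrightarrow> \<bar>x (?tk k + \<tau>) $ r\<bar> < C k * exp (- \<beta> * \<tau>) * \<xi> (?i k) Tb $ r)"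
      proof
        fix r
        show "(\<tau> \<le> Tb \<longrightarrow> \<bar>x (?tk k + \<tau>) $ r\<bar> < C k * \<xi> (?i k) \<tau> $ r) \<and>
          (Tb \<le> \<tau> \<longrightarrow> \<bar>x (?tk k + \<tau>) $ r\<bar> < C k * exp (- \<beta> * \<tau>) * \<xi> (?i k) Tb $ r)"
          by (rule bound[OF mode[OF k(1)] C dwell_trajectory_phase[OF \<sigma> Tb_pos x ph]]) (use P k in auto)
      qed
    next
      fix k
      assume k: "t (Suc k) < \<infinity>"
      note last = in_phase_last[OF \<sigma> Tb_pos k]
      assume "\<forall>r. (?tk (Suc k) - ?tk k \<le> Tb \<longrightarrow>
          \<bar>x (?tk k + (?tk (Suc k) - ?tk k)) $ r\<bar> < C k * \<xi> (?i k) (?tk (Suc k) - ?tk k) $ r) \<and>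
        (Tb \<le> ?tk (Suc k) - ?tk k \<longrightarrow> \<bar>x (?tk k + (?tk (Suc k) - ?tk k)) $ r\<bar>
          < C k * exp (- \<beta> * (?tk (Suc k) - ?tk k)) * \<xi> (?i k) Tb $ r)"
      moreover have "C k * exp (- \<beta> * (?tk (Suc k) - ?tk k)) = C (Suc k)"
        by (simp add: C_def mult.assoc exp_add[symmetric] algebra_simps)
      ultimately have Q: "\<bar>x (?tk (Suc k)) $ r\<bar> < C (Suc k) * \<xi> (?i k) Tb $ r" for r
        using last(3) by simp
      show "\<forall>r. \<bar>x (?tk (Suc k)) $ r\<bar> < C (Suc k) * \<xi> (?i (Suc k)) 0 $ r"
      proof
        fix r
        note Q[of r]
        also have "C (Suc k) * \<xi> (?i k) Tb $ r \<le> C (Suc k) * \<xi> (?i (Suc k)) 0 $ r"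
          using C[of "Suc k"]
          by (intro mult_left_mono \<xi>_switch mode phase_mode_changes[OF \<sigma> Tb_pos] k last(1)) auto
        finally show "\<bar>x (?tk (Suc k)) $ r\<bar> < C (Suc k) * \<xi> (?i (Suc k)) 0 $ r" .
      qed
    qed
    have CL: "C k * R \<le> c * L * exp (- \<beta> * (?tk k + \<tau>))" if "\<tau> \<le> Tb" for k \<tau>
    proof -
      have "exp (- \<beta> * ?tk k) \<le> exp (\<beta> * Tb + - \<beta> * (?tk k + \<tau>))"
        using that \<beta> by (simp add: algebra_simps)
      then have "(c * R) * exp (- \<beta> * ?tk k) \<le> (c * R) * (exp (\<beta> * Tb) * exp (- \<beta> * (?tk k + \<tau>)))"
        using c R(1) unfolding exp_add by (intro mult_left_mono) auto
      then show ?thesis by (simp add: C_def L_def mult_ac)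
    qed
    show "\<bar>x s $ r\<bar> \<le> c * L * exp (- \<beta> * s)"
    proof (cases "s = 0")
      case True
      have "\<bar>x 0 $ r\<bar> \<le> c * m" using init[of r] by simp
      also have "\<dots> \<le> c * R"
        using m(2)[OF mode, of 0 r] R(2)[OF mode, of 0 0 r] t0 c Tb_pos by simp
      also have "\<dots> \<le> c * L * exp (- \<beta> * 0)"
        using CL[of 0 0] Tb_pos t0 by (simp add: C_def)
      finally show ?thesis using True by simp
    next
      case False
      then obtain k \<tau> where ph: "in_phase t k \<tau>" and s_eq: "s = ?tk k + \<tau>"
        using time_in_some_phase[OF \<sigma> Tb_pos, of s] s by auto
      have k: "t k < \<infinity>" "0 < \<tau>" using ph by (simp_all add: in_phase_def)
      show ?thesis
      proof (cases "\<tau> \<le> Tb")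
        case True
        then have "\<bar>x s $ r\<bar> \<le> C k * \<xi> (?i k) \<tau> $ r" using inv[OF ph] s_eq by (simp add: less_imp_le)
        also have "\<dots> \<le> C k * R"
          using R(2)[OF mode[OF k(1)], of \<tau> r] C[of k] True k by simp
        also note CL[OF True]
        finally show ?thesis by (simp add: s_eq)
      next
        case False
        then have "\<bar>x s $ r\<bar> \<le> C k * exp (- \<beta> * \<tau>) * \<xi> (?i k) Tb $ r"
          using inv[OF ph] s_eq by (simp add: less_imp_le)
        also have "\<dots> \<le> C k * exp (- \<beta> * \<tau>) * R"
          using R(2)[OF mode[OF k(1)], of Tb r] C[of k] Tb_pos by simp
        also have "\<dots> = C k * R * exp (- \<beta> * \<tau>)" by simp
        also have "\<dots> \<le> c * L * exp (- \<beta> * ?tk k) * exp (- \<beta> * \<tau>)"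
          using CL[of 0 k] Tb_pos by (intro mult_right_mono) auto
        also have "\<dots> = c * L * exp (- \<beta> * s)"
          by (simp add: s_eq mult.assoc exp_add[symmetric] algebra_simps)
        finally show ?thesis .
      qed
    qed
  qed
qed

end

section \<open>Diagonal certificates\<close>

lemma diagonal_matrix_matrix_mult:
  fixes P :: "real^'n^'m"
  assumes "diagonal X"
  shows "(P ** X) $ r $ s = P $ r $ s * X $ s $ s"
proof -
  have "(\<Sum>k\<in>UNIV-{s}. P $ r $ k * X $ k $ s) = 0"
    using assms by (intro sum.neutral) (auto simp: diagonal_def)
  then show ?thesis
    by (simp add: matrix_matrix_mult_def sum.remove[of UNIV s])
qed

lemma diagonal_matrix_vector_one:
  fixes X :: "real^'n^'n"
  assumes "diagonal X"
  shows "(X *v 1) $ r = X $ r $ r"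
proof -
  have "(\<Sum>k\<in>UNIV-{r}. X $ r $ k * 1 $ k) = 0"
    using assms by (intro sum.neutral) (auto simp: diagonal_def)
  then show ?thesis by (simp add: matrix_vector_mult_split_diagonal)
qed

lemma matrix_inv_mult:
  fixes X :: "real^'n^'n"
  assumes "invertible X"
  shows "matrix_inv X ** X = mat 1"
  using someI_ex[OF assms[unfolded invertible_def]] by (simp add: matrix_inv_def)

lemma matrix_inv_diagonal:
  fixes X :: "real^'n^'n"
  assumes "diagonal X" "invertible X"
  shows "X $ r $ r \<noteq> 0" "matrix_inv X = (\<chi> r s. if r = s then 1 / X $ s $ s else 0)"
proof -
  have *: "matrix_inv X $ r $ s * X $ s $ s = (if r = s then 1 else 0)" for r s
    using diagonal_matrix_matrix_mult[OF assms(1), of "matrix_inv X" r s] matrix_inv_mult[OF assms(2)]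
    by (simp add: mat_def)
  show nz: "X $ r $ r \<noteq> 0" for r using *[of r r] by auto
  show "matrix_inv X = (\<chi> r s. if r = s then 1 / X $ s $ s else 0)"
    unfolding vec_eq_iff
  proof (intro allI)
    fix r s
    show "matrix_inv X $ r $ s = (\<chi> r s. if r = s then 1 / X $ s $ s else 0) $ r $ s"
      using *[of r s] nz[of s] by (auto simp: field_simps)
  qed
qed

lemma continuous_on_matrix_inv_diagonal:
  fixes X :: "'a::topological_space \<Rightarrow> real^'n^'n"
  assumes "continuous_on S X" "\<And>s. s \<in> S \<Longrightarrow> diagonal (X s)" "\<And>s. s \<in> S \<Longrightarrow> invertible (X s)"
  shows "continuous_on S (\<lambda>s. matrix_inv (X s))"
proof -
  have "continuous_on S (\<lambda>s. if r = q then 1 / X s $ q $ q else 0)" for r q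
    using assms(1) matrix_inv_diagonal(1)[OF assms(2,3)] by (cases "r = q") (auto intro!: continuous_intros)
  then have "continuous_on S (\<lambda>s. (\<chi> r q. if r = q then 1 / X s $ q $ q else 0) :: real^'n^'n)"
    by (intro continuous_intros)
  then show ?thesis
    by (rule continuous_on_eq) (simp add: matrix_inv_diagonal(2) assms)
qed

lemma positive_definite_diagonal_entry:
  fixes P :: "real^'n^'n"
  assumes "positive_definite P"
  shows "0 < P $ r $ r"
proof -
  have "axis r (1::real) \<noteq> 0" by (simp add: axis_eq_0_iff)
  then have "0 < axis r 1 \<bullet> (P *v axis r 1)"
    using assms unfolding positive_definite_def by blast
  then show ?thesis
    by (simp add: inner_axis' matrix_vector_mult_basis column_def)
qed

text \<open>
  A diagonal entry that is positive at \<open>b\<close> and nonpositive earlier would vanish in between, contradicting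
  invertibility.
\<close>

lemma diagonal_entries_stay_positive:
  fixes X :: "real \<Rightarrow> real^'n^'n"
  assumes "continuous_on {a..b} X" "\<And>s. s \<in> {a..b} \<Longrightarrow> diagonal (X s)"
    "\<And>s. s \<in> {a..b} \<Longrightarrow> invertible (X s)" "positive_definite (X b)" "s \<in> {a..b}"
  shows "0 < X s $ r $ r"
proof (rule ccontr)
  assume "\<not> 0 < X s $ r $ r"
  moreover have "continuous_on {s..b} (\<lambda>s. X s $ r $ r)"
    using assms(1,5) by (intro continuous_intros) (auto elim: continuous_on_subset)
  ultimately obtain u where "s \<le> u" "u \<le> b" "X u $ r $ r = 0"
    using IVT'[of "\<lambda>s. X s $ r $ r" s 0 b] positive_definite_diagonal_entry[OF assms(4), of r] assms(5)
    by force
  then show False using matrix_inv_diagonal(1)[OF assms(2,3), of u r] assms(5) by auto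
qed

section \<open>Essential bounds and measurability of the output\<close>

lemma infnorm_cart_le_iff: "infnorm (v :: real^'n) \<le> c \<longleftrightarrow> (\<forall>r. \<bar>v $ r\<bar> \<le> c)"
proof
  assume "\<forall>r. \<bar>v $ r\<bar> \<le> c"
  then show "infnorm v \<le> c" unfolding infnorm_cart by (intro cSup_least) auto
qed (metis component_le_infnorm_cart order_trans)

lemma Linf_norm_boundD:
  fixes w :: "real \<Rightarrow> real^'p"
  assumes "Linf_norm w \<le> ereal c"
  obtains W where "negligible W" "\<And>s r. 0 \<le> s \<Longrightarrow> s \<notin> W \<Longrightarrow> \<bar>w s $ r\<bar> \<le> c"
proof -
  have "AE s in lebesgue_on {0..}. ereal (infnorm (w s)) \<le> Linf_norm w"
    unfolding Linf_norm_def by (rule esssup_AE)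
  then have "AE s in lebesgue_on {0..}. infnorm (w s) \<le> c"
    using assms by (auto elim!: eventually_mono dest: order_trans)
  then have "AE s in lebesgue. s \<in> {0..} \<longrightarrow> infnorm (w s) \<le> c"
    by (subst (asm) AE_restrict_space_iff) auto
  then obtain W where "W \<in> null_sets lebesgue" "{s. \<not> (s \<in> {0..} \<longrightarrow> infnorm (w s) \<le> c)} \<subseteq> W"
    unfolding eventually_ae_filter by auto
  then show ?thesis
    by (intro that[of W]) (auto simp: negligible_iff_null_sets infnorm_cart_le_iff)
qed

lemma Linf_norm_boundI:
  fixes z :: "real \<Rightarrow> real^'q"
  assumes "z \<in> borel_measurable (lebesgue_on {0..})" "negligible W"
    and "\<And>s r. 0 \<le> s \<Longrightarrow> s \<notin> W \<Longrightarrow> \<bar>z s $ r\<bar> \<le> c"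
  shows "Linf_norm z \<le> ereal c"
  unfolding Linf_norm_def
proof (rule esssup_I)
  have "continuous_on UNIV (infnorm :: real^'q \<Rightarrow> real)"
    by (simp add: continuous_at_imp_continuous_on continuous_infnorm)
  then have "(\<lambda>s. infnorm (z s)) \<in> borel_measurable (lebesgue_on {0..})"
    using assms(1) by (rule borel_measurable_continuous_on)
  then show "(\<lambda>s. ereal (infnorm (z s))) \<in> borel_measurable (lebesgue_on {0..})" by simp
  have "W \<in> null_sets lebesgue" using assms(2) by (simp add: negligible_iff_null_sets)
  then have "AE s in lebesgue. s \<in> {0..} \<longrightarrow> infnorm (z s) \<le> c"
    by (rule AE_I') (use assms(3) in \<open>auto simp: infnorm_cart_le_iff\<close>)
  then show "AE s in lebesgue_on {0..}. ereal (infnorm (z s)) \<le> ereal c"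
    by (subst AE_restrict_space_iff) auto
qed

lemma borel_measurable_matrix_vector_mult:
  fixes P :: "'a \<Rightarrow> real^'n^'m"
  assumes "P \<in> borel_measurable L" "v \<in> borel_measurable L"
  shows "(\<lambda>s. P s *v v s) \<in> borel_measurable L"
  using assms by (rule borel_measurable_continuous_Pair) (intro continuous_intros)

text \<open>
  The essential supremum of a non-measurable function is infinite, so a pointwise bound on the output
  says nothing about its norm without measurability. The phases and the point \<open>0\<close>, which lies in no phase, form a
  countable measurable cover.
\<close>

lemma dwell_output_measurable:
  fixes H :: "nat \<Rightarrow> real \<Rightarrow> real^'n^'q" and F :: "nat \<Rightarrow> real \<Rightarrow> real^'p^'q"
  assumes \<sigma>: "dwell_signal Tb N t \<sigma>" "Tb > 0"
    and HF: "\<And>k. t k < \<infinity> \<Longrightarrow> continuous_on {0..} (H k)" "\<And>k. t k < \<infinity> \<Longrightarrow> continuous_on {0..} (F k)"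
    and x: "continuous_on {0..} x" and w: "w \<in> borel_measurable (lebesgue_on {0..})"
    and z: "\<And>k \<tau>. in_phase t k \<tau> \<Longrightarrow> z (real_of_ereal (t k) + \<tau>)
        = H k \<tau> *v x (real_of_ereal (t k) + \<tau>) + F k \<tau> *v w (real_of_ereal (t k) + \<tau>)"
  shows "z \<in> borel_measurable (lebesgue_on {0..})"
proof (rule measurable_piecewise_restrict)
  define \<Omega> where "\<Omega> k = {s. t k < ereal s \<and> ereal s \<le> t (Suc k)}" for k
  show "countable (insert {0} (range \<Omega>))" by simp
  have \<Omega>: "\<Omega> k \<in> sets lebesgue" for k
  proof -
    have "\<Omega> k \<in> sets borel" unfolding \<Omega>_def by measurable
    then show ?thesis by simp
  qed
  have mem: "real_of_ereal (t k) + \<tau> \<in> \<Omega> k" if "in_phase t k \<tau>" for k \<tau>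
  proof -
    have "t k = ereal (real_of_ereal (t k))"
      using dwell_switch_time_finite(1)[OF \<sigma>] that by (simp add: in_phase_def)
    then obtain a where "t k = ereal a" by metis
    then show ?thesis using that by (simp add: \<Omega>_def in_phase_def)
  qed
  show "space (lebesgue_on {0..}) \<subseteq> \<Union> (insert {0} (range \<Omega>))"
  proof
    fix s :: real assume "s \<in> space (lebesgue_on {0..})"
    then consider "s = 0" | "s > 0" by force
    then show "s \<in> \<Union> (insert {0} (range \<Omega>))"
    proof cases
      case 2
      then obtain k \<tau> where "in_phase t k \<tau>" "s = real_of_ereal (t k) + \<tau>"
        using time_in_some_phase[OF \<sigma>] by metis
      then have "s \<in> \<Omega> k" using mem by simp
      then show ?thesis by blast
    qed simp
  qed
  fix Y assume Y: "Y \<in> insert {0} (range \<Omega>)"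
  show "Y \<inter> space (lebesgue_on {0..}) \<in> sets (lebesgue_on {0..})"
    using Y \<Omega> by (auto simp: sets_restrict_space_iff Int_commute)
  from Y consider "Y = {0}" | k where "Y = \<Omega> k" by auto
  then show "z \<in> borel_measurable (restrict_space (lebesgue_on {0..}) Y)"
  proof cases
    case 1
    have "(\<lambda>_. z 0) \<in> borel_measurable (restrict_space (lebesgue_on {0..}) Y)" by simp
    then show ?thesis by (rule measurable_cong[THEN iffD1, rotated]) (simp add: 1 space_restrict_space)
  next
    case (2 k)
    (* The maximum extends the coefficients, given for nonnegative timer values, to all times. *)
    define rhs where "rhs s = (if t k < \<infinity> then H k (max 0 (s - real_of_ereal (t k))) *v x s
        + F k (max 0 (s - real_of_ereal (t k))) *v w s else 0)" for s
    have "rhs \<in> borel_measurable (lebesgue_on {0..})"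
    proof (cases "t k < \<infinity>")
      case True
      have cont: "(\<lambda>s. G (max 0 (s - real_of_ereal (t k)))) \<in> borel_measurable (lebesgue_on {0..})"
        if "continuous_on {0..} G" for G :: "real \<Rightarrow> 'b::euclidean_space"
        by (rule continuous_imp_measurable_on_sets_lebesgue)
          (auto intro!: continuous_on_compose2[OF that] continuous_intros)
      have "x \<in> borel_measurable (lebesgue_on {0..})"
        using x by (rule continuous_imp_measurable_on_sets_lebesgue) simp
      then show ?thesis
        unfolding rhs_def using True HF[OF True] w
        by (auto intro!: borel_measurable_add borel_measurable_matrix_vector_mult cont)
    next
      case False
      then have "rhs = (\<lambda>_. 0)" by (simp add: rhs_def fun_eq_iff)
      then show ?thesis by simp
    qed
    then have "rhs \<in> borel_measurable (restrict_space (lebesgue_on {0..}) Y)"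
      by (rule measurable_restrict_space1)
    then show ?thesis
    proof (rule measurable_cong[THEN iffD1, rotated])
      fix s assume "s \<in> space (restrict_space (lebesgue_on {0..}) Y)"
      then have s: "t k < ereal s" "ereal s \<le> t (Suc k)" by (auto simp: 2 \<Omega>_def space_restrict_space)
      then have fin: "t k < \<infinity>" by (cases "t k") auto
      then obtain a where a: "t k = ereal a" using dwell_switch_time_finite(1)[OF \<sigma>] by metis
      then have "in_phase t k (s - a)" using s by (simp add: in_phase_def)
      from z[OF this] show "rhs s = z s" using s fin by (simp add: rhs_def a max_absorb2)
    qed
  qed
qed

section \<open>The closed loop\<close>

text \<open>
  The gain is held constant after \<open>Tb\<close>. Besides the closed-loop dynamics this is also the map from state to
  output, with \<open>C\<close> and \<open>D\<close> in the roles of \<open>A\<close> and \<open>B\<close>.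
\<close>

definition closed_loop ::
  "real \<Rightarrow> (nat \<Rightarrow> real \<Rightarrow> real^'n^'r) \<Rightarrow> (nat \<Rightarrow> real \<Rightarrow> real^'m^'r) \<Rightarrow> (nat \<Rightarrow> real \<Rightarrow> real^'n^'m) \<Rightarrow>
   nat \<Rightarrow> real \<Rightarrow> real^'n^'r" where
  "closed_loop Tb A B K i \<tau> = A i \<tau> + B i \<tau> ** K i (min \<tau> Tb)"

lemma state_feedback_in_phase:
  assumes "dwell_signal Tb N t \<sigma>" "Tb > 0" "state_feedback Tb K t \<sigma> x u" "in_phase t k \<tau>"
  shows "u (real_of_ereal (t k) + \<tau>) = K (phase_mode Tb t \<sigma> k) (min \<tau> Tb) *v x (real_of_ereal (t k) + \<tau>)"
  using assms(3,4) in_phase_mode[OF assms(1,2,4)]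
  by (auto simp: state_feedback_def Let_def min_def)

lemma closed_loop_trajectory:
  assumes "dwell_signal Tb N t \<sigma>" "Tb > 0"
    and "state_equation A B E t \<sigma> u w x" "state_feedback Tb K t \<sigma> x u"
  shows "dwell_trajectory (closed_loop Tb A B K) (phase_mode Tb t \<sigma>) t
    (\<lambda>k s. E (phase_mode Tb t \<sigma> k) s *v w (real_of_ereal (t k) + s)) x"
  unfolding dwell_trajectory_def
proof (intro conjI allI impI)
  show "continuous_on {0..} x" using assms(3) by (simp add: state_equation_def)
  fix k \<tau> assume ph: "in_phase t k \<tau>"
  let ?tk = "real_of_ereal (t k)" and ?i = "phase_mode Tb t \<sigma> k"
  have "((\<lambda>s. A (\<sigma> (?tk + s)) s *v x (?tk + s) + B (\<sigma> (?tk + s)) s *v u (?tk + s)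
       + E (\<sigma> (?tk + s)) s *v w (?tk + s)) has_integral (x (?tk + \<tau>) - x ?tk)) {0..\<tau>}"
    using assms(3) ph by (simp add: state_equation_def Let_def)
  then show "((\<lambda>s. closed_loop Tb A B K ?i s *v x (?tk + s) + E ?i s *v w (?tk + s)) has_integral
      (x (?tk + \<tau>) - x ?tk)) {0..\<tau>}"
  (* At timer value 0 the signals still carry the previous mode. *)
  proof (rule has_integral_spike[OF negligible_sing[of 0], rotated])
    fix s assume "s \<in> {0..\<tau>} - {0}"
    then have "in_phase t k s" using in_phase_mono[OF ph] by simp
    then show "closed_loop Tb A B K ?i s *v x (?tk + s) + E ?i s *v w (?tk + s) =
        A (\<sigma> (?tk + s)) s *v x (?tk + s) + B (\<sigma> (?tk + s)) s *v u (?tk + s)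
       + E (\<sigma> (?tk + s)) s *v w (?tk + s)"
      using state_feedback_in_phase[OF assms(1,2,4)] in_phase_mode[OF assms(1,2)]
      by (simp add: closed_loop_def matrix_vector_mult_add_rdistrib matrix_vector_mul_assoc)
  qed
qed

lemma closed_loop_output:
  assumes "dwell_signal Tb N t \<sigma>" "Tb > 0"
    and "output_equation C D F t \<sigma> u w x z" "state_feedback Tb K t \<sigma> x u" "in_phase t k \<tau>"
  shows "z (real_of_ereal (t k) + \<tau>)
    = closed_loop Tb C D K (phase_mode Tb t \<sigma> k) \<tau> *v x (real_of_ereal (t k) + \<tau>)
      + F (phase_mode Tb t \<sigma> k) \<tau> *v w (real_of_ereal (t k) + \<tau>)"
  using assms(3,5) state_feedback_in_phase[OF assms(1,2,4,5)] in_phase_mode[OF assms(1,2,5)]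
  by (simp add: output_equation_def Let_def closed_loop_def matrix_vector_mult_add_rdistrib
      matrix_vector_mul_assoc)

lemma continuous_on_closed_loop:
  assumes "0 \<le> Tb" "continuous_on {0..} (A i)" "continuous_on {0..} (B i)" "continuous_on {0..Tb} (K i)"
  shows "continuous_on {0..} (closed_loop Tb A B K i)"
  unfolding closed_loop_def using assms
  by (intro continuous_intros continuous_on_compose2[OF assms(4)]) auto

lemma asymptotically_stable_dwell_if_decay:
  fixes A :: "nat \<Rightarrow> real \<Rightarrow> real^'n^'n"
  assumes pos: "0 < \<beta>" "0 < m" "0 < L"
    and decay: "\<And>t \<sigma> x u c s r. dwell_signal Tb N t \<sigma> \<Longrightarrow> state_equation A B E t \<sigma> u (\<lambda>_. 0) x \<Longrightarrow>
      state_feedback Tb K t \<sigma> x u \<Longrightarrow> 0 < c \<Longrightarrow> (\<And>r. \<bar>x 0 $ r\<bar> < c * m) \<Longrightarrow> 0 \<le> s \<Longrightarrow>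
      \<bar>x s $ r\<bar> \<le> c * L * exp (- \<beta> * s)"
  shows "asymptotically_stable_dwell Tb N A B E K"
proof -
  define n where "n = real CARD('n)"
  have n: "0 < n" by (simp add: n_def)
  have norm_decay: "norm (x s) \<le> n * (c * L * exp (- \<beta> * s))"
    if \<sigma>: "dwell_signal Tb N t \<sigma>" and x: "state_equation A B E t \<sigma> u (\<lambda>_. 0) x" "state_feedback Tb K t \<sigma> x u"
      and c: "0 < c" "norm (x 0) < c * m" and s: "0 \<le> s" for t \<sigma> x u c s
  proof -
    have "\<bar>x 0 $ r\<bar> < c * m" for r using c(2) component_le_norm_cart[of "x 0" r] by linarith
    from decay[OF \<sigma> x c(1) this s] have "(\<Sum>r\<in>UNIV. \<bar>x s $ r\<bar>) \<le> n * (c * L * exp (- \<beta> * s))"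
      unfolding n_def by (intro sum_bounded_above) auto
    then show ?thesis using norm_le_l1_cart[of "x s"] by linarith
  qed
  show ?thesis
    unfolding asymptotically_stable_dwell_def
  proof (intro allI impI conjI)
    fix t \<sigma> and \<epsilon> :: real assume \<sigma>: "dwell_signal Tb N t \<sigma>" and \<epsilon>: "0 < \<epsilon>"
    define c where "c = \<epsilon> / (2 * n * L)"
    have c: "0 < c" "n * (c * L) < \<epsilon>" using \<epsilon> n pos by (auto simp: c_def field_simps)
    show "\<exists>\<delta>>0. \<forall>x u. state_equation A B E t \<sigma> u (\<lambda>_. 0) x \<and> state_feedback Tb K t \<sigma> x u \<and> norm (x 0) < \<delta>
        \<longrightarrow> (\<forall>s\<ge>0. norm (x s) < \<epsilon>)"
    proof (intro exI[of _ "c * m"] conjI allI impI)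
      show "0 < c * m" using c pos by simp
      fix x u s
      assume *: "state_equation A B E t \<sigma> u (\<lambda>_. 0) x \<and> state_feedback Tb K t \<sigma> x u \<and> norm (x 0) < c * m"
        and s: "0 \<le> (s::real)"
      have "norm (x s) \<le> n * (c * L * exp (- \<beta> * s))" using norm_decay[OF \<sigma> _ _ c(1) _ s] * by blast
      also have "\<dots> \<le> n * (c * L * 1)" using pos n c s by (intro mult_left_mono) auto
      finally show "norm (x s) < \<epsilon>" using c by simp
    qed
  next
    fix t \<sigma> x u assume \<sigma>: "dwell_signal Tb N t \<sigma>"
      and *: "state_equation A B E t \<sigma> u (\<lambda>_. 0) x \<and> state_feedback Tb K t \<sigma> x u"
    define c where "c = (norm (x 0) + 1) / m"
    have c: "0 < c" "norm (x 0) < c * m" using pos by (auto simp: c_def add_nonneg_pos)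
    have "((\<lambda>s. n * (c * L * exp (- \<beta> * s))) \<longlongrightarrow> 0) at_top"
      using pos(1) by real_asymp
    then show "(x \<longlongrightarrow> 0) at_top"
    proof (rule Lim_null_comparison[rotated])
      show "\<forall>\<^sub>F s in at_top. norm (x s) \<le> n * (c * L * exp (- \<beta> * s))"
        using eventually_ge_at_top[of 0] by eventually_elim (use norm_decay[OF \<sigma> conjunct1[OF *] conjunct2[OF *] c] in blast)
    qed
  qed
qed

lemma bounded_linear_matrix_vector_mult_left:
  "bounded_linear (\<lambda>P :: real^'n^'m. P *v v)"
  unfolding linear_conv_bounded_linear[symmetric]
  by (rule linearI) (simp_all add: matrix_vector_mult_add_rdistrib scaleR_matrix_vector_assoc)

lemma matrix_add_rdistrib:
  fixes P Q :: "real^'n^'m"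
  shows "(P + Q) ** R = P ** R + Q ** R"
  by (vector matrix_matrix_mult_def sum.distrib[symmetric] field_simps)

lemma timer_coeff_min: "timer_coeff Tb P \<Longrightarrow> P (min \<tau> Tb) = P \<tau>"
  unfolding timer_coeff_def by (metis linorder_le_cases min.absorb1 min.absorb2)

lemma timer_coeff_continuous: "timer_coeff Tb P \<Longrightarrow> continuous_on {0..} P"
  by (simp add: timer_coeff_def)

lemma feedback_times_certificate:
  fixes P :: "real^'n^'r" and B :: "real^'m^'r" and U :: "real^'n^'m"
  assumes "invertible X"
  shows "(P + B ** (U ** matrix_inv X)) ** X = P ** X + B ** U"
  by (simp add: matrix_add_rdistrib matrix_mul_assoc[symmetric] matrix_inv_mult[OF assms])

section \<open>Stability and gain under minimum dwell time\<close>

theorem theorem5p4: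
  fixes Tb \<gamma> \<alpha> :: real and N :: nat
    and A :: "nat \<Rightarrow> real \<Rightarrow> real^'n^'n"
    and B :: "nat \<Rightarrow> real \<Rightarrow> real^'m^'n"
    and E :: "nat \<Rightarrow> real \<Rightarrow> real^'p^'n"
    and C :: "nat \<Rightarrow> real \<Rightarrow> real^'n^'q"
    and D :: "nat \<Rightarrow> real \<Rightarrow> real^'m^'q"
    and F :: "nat \<Rightarrow> real \<Rightarrow> real^'p^'q"
    and X :: "nat \<Rightarrow> real \<Rightarrow> real^'n^'n"
    and U :: "nat \<Rightarrow> real \<Rightarrow> real^'n^'m"
  assumes "Tb > 0" and "N \<ge> 1"
    and "\<And>i. i \<in> {1..N} \<Longrightarrow>
           timer_coeff Tb (A i) \<and> timer_coeff Tb (B i) \<and> timer_coeff Tb (E i) \<and>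
           timer_coeff Tb (C i) \<and> timer_coeff Tb (D i) \<and> timer_coeff Tb (F i)"
    and "internally_positive N A E C F"
    and "\<And>i. i \<in> {1..N} \<Longrightarrow> X i differentiable_on {0..Tb}"
    and "\<And>i \<tau>. i \<in> {1..N} \<Longrightarrow> \<tau> \<in> {0..Tb} \<Longrightarrow> diagonal (X i \<tau>)"
    and "\<And>i. i \<in> {1..N} \<Longrightarrow> positive_definite (X i Tb)"
    and "\<And>i \<tau>. i \<in> {1..N} \<Longrightarrow> \<tau> \<in> {0..Tb} \<Longrightarrow> invertible (X i \<tau>)"
    and "\<And>i. i \<in> {1..N} \<Longrightarrow> continuous_on {0..Tb} (U i)"
    and "\<gamma> > 0" and "\<alpha> > 0"
    and "\<And>i \<tau>. i \<in> {1..N} \<Longrightarrow> \<tau> \<in> {0..Tb} \<Longrightarrow>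
           0 \<le> A i \<tau> ** X i \<tau> + B i \<tau> ** U i \<tau> + \<alpha> *\<^sub>R mat 1"
    and "\<And>i \<tau>. i \<in> {1..N} \<Longrightarrow> \<tau> \<in> {0..Tb} \<Longrightarrow>
           0 \<le> C i \<tau> ** X i \<tau> + D i \<tau> ** U i \<tau>"
    and "\<And>i r. i \<in> {1..N} \<Longrightarrow>
           ((A i Tb ** X i Tb + B i Tb ** U i Tb) *v 1 + E i Tb *v 1) $ r < 0"
    and "\<And>i r. i \<in> {1..N} \<Longrightarrow>
           ((C i Tb ** X i Tb + D i Tb ** U i Tb) *v 1 + F i Tb *v 1 - \<gamma> *\<^sub>R 1) $ r < 0"
    and "\<And>i \<tau> r. i \<in> {1..N} \<Longrightarrow> \<tau> \<in> {0..Tb} \<Longrightarrow>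
           ((- vector_derivative (X i) (at \<tau> within {0..Tb}) + A i \<tau> ** X i \<tau> + B i \<tau> ** U i \<tau>) *v 1
             + E i \<tau> *v 1) $ r < 0"
    and "\<And>i \<tau> r. i \<in> {1..N} \<Longrightarrow> \<tau> \<in> {0..Tb} \<Longrightarrow>
           ((C i \<tau> ** X i \<tau> + D i \<tau> ** U i \<tau>) *v 1 + F i \<tau> *v 1 - \<gamma> *\<^sub>R 1) $ r < 0"
    and "\<And>i j. i \<in> {1..N} \<Longrightarrow> j \<in> {1..N} \<Longrightarrow> i \<noteq> j \<Longrightarrow> X i Tb - X j 0 \<le> 0"
  shows "asymptotically_stable_dwell Tb N A B E (\<lambda>i \<tau>. U i \<tau> ** matrix_inv (X i \<tau>)) \<and>
         Linf_gain_dwell Tb N A B E C D F (\<lambda>i \<tau>. U i \<tau> ** matrix_inv (X i \<tau>)) \<le> ereal \<gamma>"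
proof -
  have Tb: "0 < Tb" by fact
  define K where "K = (\<lambda>i \<tau>. U i \<tau> ** matrix_inv (X i \<tau>))"
  define M where "M = closed_loop Tb A B K"
  define H where "H = closed_loop Tb C D K"
  define e where "e i \<tau> = E i \<tau> *v 1" for i \<tau>
  define \<xi> where "\<xi> i \<tau> = X i \<tau> *v 1" for i \<tau>
  define \<xi>' where "\<xi>' i \<tau> = vector_derivative (X i) (at \<tau> within {0..Tb}) *v 1" for i \<tau>
  have coeff: "timer_coeff Tb (A i)" "timer_coeff Tb (B i)" "timer_coeff Tb (E i)"
    "timer_coeff Tb (C i)" "timer_coeff Tb (D i)" "timer_coeff Tb (F i)" if "i \<in> {1..N}" for i
    using assms(3)[OF that] by auto
  have E_nonneg: "0 \<le> E i \<tau> $ r $ s" and F_nonneg: "0 \<le> F i \<tau> $ r' $ s'"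
    if "i \<in> {1..N}" "0 \<le> \<tau>" for i \<tau> r s r' s'
    using assms(4) that unfolding internally_positive_def less_eq_vec_def by auto
  have X_cont: "continuous_on {0..Tb} (X i)" if "i \<in> {1..N}" for i
    using assms(5)[OF that] by (rule differentiable_imp_continuous_on)
  have X_pos: "0 < X i \<tau> $ r $ r" if "i \<in> {1..N}" "\<tau> \<in> {0..Tb}" for i \<tau> r
    using diagonal_entries_stay_positive[OF X_cont assms(6) assms(8) assms(7)] that by blast
  have \<xi>: "\<xi> i \<tau> $ r = X i \<tau> $ r $ r" if "i \<in> {1..N}" "\<tau> \<in> {0..Tb}" for i \<tau> r
    unfolding \<xi>_def by (rule diagonal_matrix_vector_one[OF assms(6)[OF that]])
  have K_cont: "continuous_on {0..Tb} (K i)" if "i \<in> {1..N}" for i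
    unfolding K_def using assms(6,8) that
    by (intro continuous_intros assms(9) continuous_on_matrix_inv_diagonal X_cont) auto
  have M_cont: "continuous_on {0..} (M i)" and H_cont: "continuous_on {0..} (H i)"
    if "i \<in> {1..N}" for i
    unfolding M_def H_def using Tb coeff[OF that, THEN timer_coeff_continuous] K_cont[OF that]
    by (auto intro!: continuous_on_closed_loop)
  have M_min: "M i (min \<tau> Tb) = M i \<tau>" and H_min: "H i (min \<tau> Tb) = H i \<tau>"
    if "i \<in> {1..N}" for i \<tau>
    using coeff[OF that, THEN timer_coeff_min] by (simp_all add: M_def H_def closed_loop_def)
  have MX: "M i \<tau> ** X i \<tau> = A i \<tau> ** X i \<tau> + B i \<tau> ** U i \<tau>"
    and HX: "H i \<tau> ** X i \<tau> = C i \<tau> ** X i \<tau> + D i \<tau> ** U i \<tau>"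
    if "i \<in> {1..N}" "\<tau> \<in> {0..Tb}" for i \<tau>
    using that feedback_times_certificate[OF assms(8)[OF that]]
    by (simp_all add: M_def H_def closed_loop_def K_def min_absorb1)
  have M\<xi>: "M i \<tau> *v \<xi> i \<tau> = (A i \<tau> ** X i \<tau> + B i \<tau> ** U i \<tau>) *v 1"
    and H\<xi>: "H i \<tau> *v \<xi> i \<tau> = (C i \<tau> ** X i \<tau> + D i \<tau> ** U i \<tau>) *v 1"
    if "i \<in> {1..N}" "\<tau> \<in> {0..Tb}" for i \<tau>
    using MX[OF that] HX[OF that] by (simp_all add: \<xi>_def matrix_vector_mul_assoc)
  have M_metzler_dwell: "metzler (M i \<tau>)" if i: "i \<in> {1..N}" and "\<tau> \<in> {0..Tb}" for i \<tau>
    unfolding metzler_def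
  proof (intro allI impI)
    fix r s :: 'n assume "r \<noteq> s"
    then have "0 \<le> (M i \<tau> ** X i \<tau>) $ r $ s"
      using assms(12)[OF that, unfolded less_eq_vec_def, rule_format, of r s] MX[OF that] by (simp add: mat_def)
    then show "0 \<le> M i \<tau> $ r $ s"
      using X_pos[OF that, of s] diagonal_matrix_matrix_mult[OF assms(6)[OF that], of "M i \<tau>" r s]
      by (simp add: zero_le_mult_iff)
  qed
  have M_metzler: "metzler (M i \<tau>)" if "i \<in> {1..N}" "0 \<le> \<tau>" for i \<tau>
    using M_metzler_dwell[of i "min \<tau> Tb"] M_min[OF that(1), of \<tau>] that Tb by simp
  have H_nonneg_dwell: "0 \<le> H i \<tau> $ r $ s" if "i \<in> {1..N}" "\<tau> \<in> {0..Tb}" for i \<tau> r s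
  proof -
    have "0 \<le> (H i \<tau> ** X i \<tau>) $ r $ s"
      using assms(13)[OF that, unfolded less_eq_vec_def, rule_format, of r s] HX[OF that] by simp
    then show ?thesis
      using X_pos[OF that, of s] diagonal_matrix_matrix_mult[OF assms(6)[OF that], of "H i \<tau>" r s]
      by (simp add: zero_le_mult_iff)
  qed
  have H_nonneg: "0 \<le> H i \<tau> $ r $ s" if "i \<in> {1..N}" "0 \<le> \<tau>" for i \<tau> r s
    using H_nonneg_dwell[of i "min \<tau> Tb" r s] H_min[OF that(1), of \<tau>] that Tb by simp
  interpret dwell_certificate Tb N M e \<xi> \<xi>'
  proof
    fix i and s :: real and r assume i: "i \<in> {1..N}"
    show "continuous_on {0..} (e i)"
      unfolding e_def using timer_coeff_continuous[OF coeff(3)[OF i]] by (intro continuous_intros)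
    show "0 \<le> s \<Longrightarrow> 0 \<le> e i s $ r"
      using E_nonneg[OF i] by (simp add: e_def matrix_vector_mult_def sum_nonneg)
    show "Tb \<le> s \<Longrightarrow> M i s = M i Tb" using M_min[OF i, of s] by (simp add: min_absorb2)
    show "Tb \<le> s \<Longrightarrow> e i s = e i Tb"
      using timer_coeff_min[OF coeff(3)[OF i], of s] by (simp add: e_def min_absorb2)
    show "0 < \<xi> i s $ r" if "s \<in> {0..Tb}" using X_pos[OF i that] \<xi>[OF i that] by simp
    show "(\<xi> i has_vector_derivative \<xi>' i s) (at s within {0..Tb})" if "s \<in> {0..Tb}"
      unfolding \<xi>_def \<xi>'_def
      by (rule bounded_linear.has_vector_derivative[OF bounded_linear_matrix_vector_mult_left])
        (use assms(5)[OF i] that in \<open>simp add: differentiable_on_def vector_derivative_works[symmetric]\<close>)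
    show "(M i s *v \<xi> i s + e i s) $ r < \<xi>' i s $ r" if "s \<in> {0..Tb}"
      using assms(16)[OF i that, of r]
      by (simp add: M\<xi>[OF i that] e_def \<xi>'_def algebra_simps)
    show "(M i Tb *v \<xi> i Tb + e i Tb) $ r < 0"
      using assms(14)[OF i, of r] Tb by (simp add: M\<xi>[OF i] e_def)
    show "\<xi> i Tb $ r \<le> \<xi> j 0 $ r" if "j \<in> {1..N}" "i \<noteq> j" for j
      using assms(18)[OF i that] \<xi>[OF i, of Tb r] \<xi>[OF that(1), of 0 r] Tb
      by (simp add: less_eq_vec_def)
  qed (use Tb M_cont M_metzler in auto)
  have "asymptotically_stable_dwell Tb N A B E K"
  proof (rule unforced_trajectory_decay)
    fix \<beta> m L :: real
    assume "0 < \<beta>" "0 < m" "0 < L" and decay: "\<And>t \<sigma> x c s r. dwell_signal Tb N t \<sigma> \<Longrightarrow>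
      dwell_trajectory M (phase_mode Tb t \<sigma>) t (\<lambda>_ _. 0) x \<Longrightarrow> 0 < c \<Longrightarrow>
      (\<And>r. \<bar>x 0 $ r\<bar> < c * m) \<Longrightarrow> 0 \<le> s \<Longrightarrow> \<bar>x s $ r\<bar> \<le> c * L * exp (- \<beta> * s)"
    show ?thesis
    proof (rule asymptotically_stable_dwell_if_decay[OF \<open>0 < \<beta>\<close> \<open>0 < m\<close> \<open>0 < L\<close>])
      fix t \<sigma> x u c s r
      assume \<sigma>: "dwell_signal Tb N t \<sigma>" and x: "state_equation A B E t \<sigma> u (\<lambda>_. 0) x"
        "state_feedback Tb K t \<sigma> x u"
        and c: "(0::real) < c" "\<And>r. \<bar>x 0 $ r\<bar> < c * m" and s: "(0::real) \<le> s"
      have "dwell_trajectory M (phase_mode Tb t \<sigma>) t (\<lambda>_ _. 0) x"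
        using closed_loop_trajectory[OF \<sigma> Tb x] by (simp add: M_def)
      from decay[OF \<sigma> this c s] show "\<bar>x s $ r\<bar> \<le> c * L * exp (- \<beta> * s)" .
    qed
  qed
  moreover have "Linf_gain_dwell Tb N A B E C D F K \<le> ereal \<gamma>"
    unfolding Linf_gain_dwell_def
  proof (rule Sup_least, clarify)
    fix t \<sigma> and w :: "real \<Rightarrow> real^'p" and x u and z :: "real \<Rightarrow> real^'q"
    assume \<sigma>: "dwell_signal Tb N t \<sigma>" and w: "w \<in> borel_measurable (lebesgue_on {0..})" "Linf_norm w = 1"
      and x: "x 0 = 0" "state_equation A B E t \<sigma> u w x" "state_feedback Tb K t \<sigma> x u"
      and z: "output_equation C D F t \<sigma> u w x z"
    let ?tk = "\<lambda>k. real_of_ereal (t k)" and ?i = "phase_mode Tb t \<sigma>"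
    have mode: "?i k \<in> {1..N}" if "t k < \<infinity>" for k by (rule phase_mode_in_modes[OF \<sigma> Tb that])
    obtain W where W: "negligible W" "\<And>s r. 0 \<le> s \<Longrightarrow> s \<notin> W \<Longrightarrow> \<bar>w s $ r\<bar> \<le> 1"
      using Linf_norm_boundD[of w 1] w(2) by (auto simp: one_ereal_def)
    have x_bound: "\<bar>x (?tk k + \<tau>) $ r\<bar> < \<xi> (?i k) (min \<tau> Tb) $ r" if ph: "in_phase t k \<tau>" for k \<tau> r
    proof (rule forced_trajectory_bound[OF \<sigma> _ _ _ _ ph])
      show "dwell_trajectory M ?i t (\<lambda>k s. E (?i k) s *v w (?tk k + s)) x"
        unfolding M_def by (rule closed_loop_trajectory[OF \<sigma> Tb x(2,3)])
      (* the exceptional times of the disturbance, measured from the start of the phase *)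
      show "negligible ((+) (- ?tk k) ` W)" for k by (rule negligible_translation[OF W(1)])
      show "\<bar>x 0 $ r\<bar> < \<xi> i 0 $ r" if "i \<in> {1..N}" for i r using \<xi>_pos[OF that, of 0 r] Tb x(1) by simp
      fix k \<tau> s r assume ph: "in_phase t k \<tau>" and s: "s \<in> {0..\<tau>} - (+) (- ?tk k) ` W"
      have k: "t k < \<infinity>" using ph by (simp add: in_phase_def)
      have "?tk k + s \<notin> W"
      proof
        assume "?tk k + s \<in> W"
        then have "- ?tk k + (?tk k + s) \<in> (+) (- ?tk k) ` W" by (rule imageI)
        then show False using s by simp
      qed
      then show "\<bar>(E (?i k) s *v w (?tk k + s)) $ r\<bar> \<le> e (?i k) s $ r"
        unfolding e_def using s W(2)[of "?tk k + s"] dwell_switch_time_finite(2)[OF \<sigma> Tb k] E_nonneg[OF mode[OF k]]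
        by (intro abs_matrix_vector_mult_le) auto
    qed
    have z_eq: "z (?tk k + \<tau>) = H (?i k) \<tau> *v x (?tk k + \<tau>) + F (?i k) \<tau> *v w (?tk k + \<tau>)"
      if "in_phase t k \<tau>" for k \<tau>
      unfolding H_def by (rule closed_loop_output[OF \<sigma> Tb z x(3) that])
    show "Linf_norm z \<le> ereal \<gamma>"
    proof (rule Linf_norm_boundI)
      show "z \<in> borel_measurable (lebesgue_on {0..})"
        by (rule dwell_output_measurable[OF \<sigma> Tb _ _ _ w(1) z_eq])
          (use x(2) mode H_cont timer_coeff_continuous[OF coeff(6)] in \<open>auto simp: state_equation_def\<close>)
      (* Time 0 lies in no phase, so the output equation leaves the output arbitrary there. *)
      show "negligible (insert 0 W)" using W(1) by simp
      fix s r assume s: "0 \<le> s" "s \<notin> insert 0 W"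
      then obtain k \<tau> where ph: "in_phase t k \<tau>" and s_eq: "s = ?tk k + \<tau>"
        using time_in_some_phase[OF \<sigma> Tb, of s] by auto
      have k: "t k < \<infinity>" "0 < \<tau>" using ph by (simp_all add: in_phase_def)
      note i = mode[OF k(1)]
      have T: "min \<tau> Tb \<in> {0..Tb}" using k Tb by auto
      have "\<bar>z s $ r\<bar> \<le> \<bar>(H (?i k) \<tau> *v x s) $ r\<bar> + \<bar>(F (?i k) \<tau> *v w s) $ r\<bar>"
        unfolding s_eq z_eq[OF ph] by simp
      also have "\<dots> \<le> (H (?i k) \<tau> *v \<xi> (?i k) (min \<tau> Tb)) $ r + (F (?i k) \<tau> *v 1) $ r"
        using k x_bound[OF ph] W(2)[of s] s H_nonneg[OF i] F_nonneg[OF i]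
        by (intro add_mono abs_matrix_vector_mult_le) (auto simp: s_eq less_imp_le)
      also have "\<dots> = (H (?i k) (min \<tau> Tb) *v \<xi> (?i k) (min \<tau> Tb) + F (?i k) (min \<tau> Tb) *v 1) $ r"
        by (simp add: H_min[OF i] timer_coeff_min[OF coeff(6)[OF i]])
      also have "\<dots> \<le> \<gamma>"
        using assms(17)[OF i T, of r] by (simp add: H\<xi>[OF i T])
      finally show "\<bar>z s $ r\<bar> \<le> \<gamma>" .
    qed
  qed
  ultimately show ?thesis by (simp add: K_def)
qed

end
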